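(* Let $f\in\ell^p(V,m)$ for some $p\in[1,\infty]$, let $u(t,x)=\sum_{y\in V}p_t(x,y)f(y)m(y)$ be the corresponding solution of the heat equation on $[0,\infty)\times V$, and let $\mu$ be the greatest lower bound of the $\ell^2$-spectrum of the graph Laplacian. Suppose that $K:[0,\infty)\times V\to\mathbb R$ is nonnegative and is a nonincreasing $C^1$-function in $t$, and that there exists a constant $\gamma\in[0,1]$ such that for all $t\ge0$ and all $x,y\in V$ with $x\sim y$, $$\left(K(t,x)+K(t,y)-2(1-\gamma)\sqrt{K(t,x)K(t,y)}\right)^2\le\left(\frac1{D_m}K_t(t,x)-2\gamma K(t,x)\right)\left(\frac1{D_m}K_t(t,y)-2\gamma K(t,y)\right),$$ where $K_t$ denotes the partial derivative in $t$. Then $$e^{2(1-\gamma)\mu t}I(t):=e^{2(1-\gamma)\mu t}\sum_{x\in V}K(t,x)u^2(t,x)m(x)$$ (with values in $[0,\infty]$) is nonincreasing in $t\in[0,\infty)$.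
   Context: Graphs: $G=(V,E)$ is a locally finite, connected graph with a symmetric weight $\mu_{\cdot\cdot}:V\times V\to[0,\infty)$, $\mu_{xy}>0$ iff $x\sim y$ (neighbors), $\inf_{(x,y)\in E}\mu_{xy}>0$, $\deg(x):=\sum_{y}\mu_{xy}<\infty$. $m:V\to(0,\infty)$ is a measure on vertices and $D_m:=\max_{x\in V}\deg(x)/m(x)$, which is finite. $\ell^p(V,m)$ is the usual space of real functions with $\sum_x|f(x)|^pm(x)<\infty$ (bounded functions for $p=\infty$). Laplacian: $\Delta f(x)=\frac1{m(x)}\sum_{y}\mu_{xy}(f(y)-f(x))$. $\mu$ (without indices) is the infimum of the spectrum of $-\Delta$ on $\ell^2(V,m)$. Minimal heat kernel: for finite $\Omega\subset V$, $p_t(x,y,\Omega)$ is the solution $u(t,x)$ of $\partial_t u=\Delta u$ for $x\in\Omega$, $t\ge0$, $u(t,x)=0$ for $x\notin\Omega$, with $u(0,x)=\frac{1}{m(y)}\delta_y(x)$. For an exhaustion $\Omega_1\subset\Omega_2\subset\cdots$ of $V$ by finite sets, $p_t(x,y):=\lim_{i\to\infty}p_t(x,y,\Omega_i)$ (independent of the exhaustion). *)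

theory Defs
  imports "HOL-Analysis.Analysis"
begin

text \<open>
  The vertex set is the whole type \<open>'v\<close>.  A weighted graph consists of an edge relation \<open>E\<close>, an edge
  weight \<open>w\<close> and a vertex measure \<open>m\<close>.  Since \<open>E `` {x}\<close>, the set of neighbours of \<open>x\<close>, is finite and
  \<open>w x\<close> vanishes outside it, the sums over all vertices in the degree and in the Laplacian are
  written as sums over \<open>E `` {x}\<close>.
\<close>

definition weighted_deg :: "('v \<times> 'v) set \<Rightarrow> ('v \<Rightarrow> 'v \<Rightarrow> real) \<Rightarrow> 'v \<Rightarrow> real" where
  "weighted_deg E w x = (\<Sum>y\<in>E `` {x}. w x y)"

definition max_rel_deg :: "('v \<times> 'v) set \<Rightarrow> ('v \<Rightarrow> 'v \<Rightarrow> real) \<Rightarrow> ('v \<Rightarrow> real) \<Rightarrow> real" where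
  "max_rel_deg E w m = (SUP x. weighted_deg E w x / m x)"

locale weighted_graph =
  fixes E :: "('v \<times> 'v) set"
    and w :: "'v \<Rightarrow> 'v \<Rightarrow> real"
    and m :: "'v \<Rightarrow> real"
  assumes locally_finite: "\<And>x. finite (E `` {x})"
    and connected: "\<And>x y. (x, y) \<in> E\<^sup>*"
    and weight_nonneg: "\<And>x y. 0 \<le> w x y"
    and weight_sym: "\<And>x y. w x y = w y x"
    and weight_pos_iff: "\<And>x y. 0 < w x y \<longleftrightarrow> (x, y) \<in> E"
    and weight_inf_pos: "0 < (INF (x, y)\<in>E. ereal (w x y))"
    and measure_pos: "\<And>x. 0 < m x"
    and rel_deg_bounded: "bdd_above (range (\<lambda>x. weighted_deg E w x / m x))"

definition laplacian ::
    "('v \<times> 'v) set \<Rightarrow> ('v \<Rightarrow> 'v \<Rightarrow> real) \<Rightarrow> ('v \<Rightarrow> real) \<Rightarrow> ('v \<Rightarrow> real) \<Rightarrow> 'v \<Rightarrow> real" where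
  "laplacian E w m f x = 1 / m x * (\<Sum>y\<in>E `` {x}. w x y * (f y - f x))"

definition lp_space :: "('v \<Rightarrow> real) \<Rightarrow> ereal \<Rightarrow> ('v \<Rightarrow> real) set" where
  "lp_space m p =
     (if p = \<infinity> then {f. bounded (range f)}
      else {f. (\<lambda>x. \<bar>f x\<bar> powr real_of_ereal p * m x) summable_on UNIV})"

definition l2_norm :: "('v \<Rightarrow> real) \<Rightarrow> ('v \<Rightarrow> real) \<Rightarrow> real" where
  "l2_norm m f = sqrt (\<Sum>\<^sub>\<infinity>x. (f x)\<^sup>2 * m x)"

text \<open>
  \<open>\<lambda>\<close> lies in the resolvent set of an operator \<open>A\<close> on the real Hilbert space \<open>\<ell>\<^sup>2(V, m)\<close> iff \<open>A - \<lambda>\<close> is a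
  bijection of that space with bounded inverse.  Only real \<open>\<lambda>\<close> are considered: the negative Laplacian
  is self-adjoint, so the spectrum of its complexification is real and agrees with this one.
\<close>

definition l2_resolvent_set ::
    "('v \<Rightarrow> real) \<Rightarrow> (('v \<Rightarrow> real) \<Rightarrow> 'v \<Rightarrow> real) \<Rightarrow> real set" where
  "l2_resolvent_set m A =
     {l. bij_betw (\<lambda>f x. A f x - l * f x) (lp_space m 2) (lp_space m 2) \<and>
         (\<exists>C. \<forall>f\<in>lp_space m 2. l2_norm m f \<le> C * l2_norm m (\<lambda>x. A f x - l * f x))}"

definition l2_spectrum ::
    "('v \<Rightarrow> real) \<Rightarrow> (('v \<Rightarrow> real) \<Rightarrow> 'v \<Rightarrow> real) \<Rightarrow> real set" where
  "l2_spectrum m A = - l2_resolvent_set m A"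

definition spectrum_bottom ::
    "('v \<times> 'v) set \<Rightarrow> ('v \<Rightarrow> 'v \<Rightarrow> real) \<Rightarrow> ('v \<Rightarrow> real) \<Rightarrow> real" where
  "spectrum_bottom E w m = Inf (l2_spectrum m (\<lambda>f x. - laplacian E w m f x))"

text \<open>
  The initial condition is imposed on \<open>\<Omega>\<close> only, so that for \<open>y \<notin> \<Omega>\<close> it is compatible with the Dirichlet
  condition and the solution vanishes.  At \<open>t = 0\<close> the time derivative is one-sided.
\<close>

definition dirichlet_heat_solution ::
    "('v \<times> 'v) set \<Rightarrow> ('v \<Rightarrow> 'v \<Rightarrow> real) \<Rightarrow> ('v \<Rightarrow> real) \<Rightarrow> 'v set \<Rightarrow> 'v \<Rightarrow>
     (real \<Rightarrow> 'v \<Rightarrow> real) \<Rightarrow> bool" where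
  "dirichlet_heat_solution E w m \<Omega> y u \<longleftrightarrow>
     (\<forall>t\<ge>0. \<forall>x\<in>\<Omega>. ((\<lambda>s. u s x) has_real_derivative laplacian E w m (u t) x) (at t within {0..})) \<and>
     (\<forall>t\<ge>0. \<forall>x. x \<notin> \<Omega> \<longrightarrow> u t x = 0) \<and>
     (\<forall>x\<in>\<Omega>. u 0 x = (if x = y then 1 / m y else 0))"

definition dirichlet_heat_kernel ::
    "('v \<times> 'v) set \<Rightarrow> ('v \<Rightarrow> 'v \<Rightarrow> real) \<Rightarrow> ('v \<Rightarrow> real) \<Rightarrow> 'v set \<Rightarrow> real \<Rightarrow> 'v \<Rightarrow> 'v \<Rightarrow> real" where
  "dirichlet_heat_kernel E w m \<Omega> t x y =
     (THE r. \<exists>u. dirichlet_heat_solution E w m \<Omega> y u \<and> r = u t x)"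

definition exhaustion :: "(nat \<Rightarrow> 'v set) \<Rightarrow> bool" where
  "exhaustion \<Omega> \<longleftrightarrow> incseq \<Omega> \<and> (\<forall>i. finite (\<Omega> i)) \<and> (\<Union>i. \<Omega> i) = UNIV"

definition heat_kernel ::
    "('v \<times> 'v) set \<Rightarrow> ('v \<Rightarrow> 'v \<Rightarrow> real) \<Rightarrow> ('v \<Rightarrow> real) \<Rightarrow> real \<Rightarrow> 'v \<Rightarrow> 'v \<Rightarrow> real" where
  "heat_kernel E w m t x y =
     (THE r. \<forall>\<Omega>. exhaustion \<Omega> \<longrightarrow>
        (\<lambda>i. dirichlet_heat_kernel E w m (\<Omega> i) t x y) \<longlonglongrightarrow> r)"

definition heat_semigroup ::
    "('v \<times> 'v) set \<Rightarrow> ('v \<Rightarrow> 'v \<Rightarrow> real) \<Rightarrow> ('v \<Rightarrow> real) \<Rightarrow> ('v \<Rightarrow> real) \<Rightarrow> real \<Rightarrow> 'v \<Rightarrow> real" where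
  "heat_semigroup E w m f t x = (\<Sum>\<^sub>\<infinity>y. heat_kernel E w m t x y * f y * m y)"

end

theory Submission
  imports Defs
begin

text \<open>
  Put \<open>D = D\<^sub>m\<close> and \<open>Q = D + \<Delta>\<close>, a positive local operator with \<open>Q 1 = D\<close>, so that the heat semigroup is
  \<open>e\<^bsup>-Dt\<^esup> \<Sum> t\<^sup>k/k! Q\<^sup>k\<close>.  Since \<open>\<bar>f\<bar> \<le> 1 + \<bar>f\<bar>\<^sup>p\<close>, every \<open>f \<in> \<ell>\<^sup>p\<close> satisfies \<open>Q\<^sup>k \<bar>f\<bar> x \<le> B\<^sub>x D\<^sup>k\<close>, and all
  series converge absolutely at each vertex; Dirichlet solutions converge to \<open>u\<close> because
  \<open>(\<one>\<^sub>\<Omega> Q)\<^sup>k f x\<close> is eventually equal to \<open>Q\<^sup>k f x\<close> along an exhaustion.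

  For a Dirichlet solution \<open>v\<close> on a finite set, write the derivative of \<open>J = \<Sum> K v\<^sup>2 m\<close> as a sum over
  edges, bounding \<open>K\<^sub>t m\<close> by \<open>K\<^sub>t deg / D\<close>, and add \<open>2(1 - \<gamma>)\<mu> J\<close>, estimated by the Rayleigh quotient of
  \<open>\<surd>K v\<close>.  What remains on each edge is a quadratic form in \<open>(v x, v y)\<close> whose discriminant
  condition is the hypothesis on \<open>K\<close>, so it is nonpositive.  Restarting the heat flow at time \<open>s\<close> from the
  truncations of \<open>u(s)\<close> to an exhaustion and applying Fatou gives the monotonicity of \<open>I\<close>.

  The Rayleigh bound with constant \<open>\<mu>\<close> holds since the optimal constant lies in the spectrum.
\<close>

section \<open>The positive operator obtained by shifting the Laplacian\<close>

lemma has_sum_finite_sum: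
  fixes f :: "'b \<Rightarrow> 'c \<Rightarrow> real"
  assumes "\<And>y. y \<in> B \<Longrightarrow> (f y has_sum s y) A"
  shows "((\<lambda>k. \<Sum>y\<in>B. f y k) has_sum (\<Sum>y\<in>B. s y)) A"
  using assms by (induction B rule: infinite_finite_induct) (auto intro: has_sum_add)

text \<open>Tonelli for the nonnegative majorant \<open>a'\<close> makes \<open>a\<close> absolutely
  summable over the product; evaluating the double sum by rows then forces the value
  \<open>s\<close>.\<close>

lemma has_sum_prodI:
  fixes a a' :: "'i \<Rightarrow> 'j \<Rightarrow> real"
  assumes rows: "\<And>i. (a i has_sum b i) UNIV"
    and total: "(b has_sum s) UNIV"
    and dom: "\<And>i j. \<bar>a i j\<bar> \<le> a' i j"
    and dom_rows: "\<And>i. (a' i has_sum b' i) UNIV"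
    and dom_summable: "b' summable_on UNIV"
  shows "((\<lambda>(i, j). a i j) has_sum s) (UNIV \<times> UNIV)"
proof -
  have "(\<lambda>(i, j). a' i j) summable_on (UNIV \<times> UNIV)"
    by (rule summable_on_SigmaI[OF _ dom_summable])
      (use dom_rows order_trans[OF abs_ge_zero dom] in auto)
  then have "(\<lambda>z. norm (case z of (i, j) \<Rightarrow> a i j)) summable_on (UNIV \<times> UNIV)"
    by (rule summable_on_comparison_test) (use dom in auto)
  then have "(\<lambda>(i, j). a i j) summable_on (UNIV \<times> UNIV)"
    by (rule abs_summable_summable)
  then obtain r where r: "((\<lambda>(i, j). a i j) has_sum r) (UNIV \<times> UNIV)"
    by (auto simp: summable_on_def)
  have "(b has_sum r) UNIV"
    by (rule has_sum_SigmaD[OF r]) (use rows in auto)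
  with total have "r = s" by (rule has_sum_unique[rotated])
  with r show ?thesis by simp
qed

text \<open>The double sum read by columns; together with \<open>has_sum_prodI\<close> this
  exchanges two iterated sums.\<close>

lemma has_sum_swap_cols:
  assumes "((\<lambda>(i, j). a i j) has_sum s) (UNIV \<times> UNIV)"
    and cols: "\<And>j. ((\<lambda>i. a i j) has_sum c j) UNIV"
  shows "(c has_sum (s::real)) UNIV"
proof -
  have "((\<lambda>(j, i). a i j) has_sum s) (UNIV \<times> UNIV)"
    using assms(1) unfolding has_sum_swap[of "\<lambda>(i, j). a i j"] by simp
  then show ?thesis
    by (rule has_sum_SigmaD) (use cols in auto)
qed

context weighted_graph
begin

abbreviation D :: real where "D \<equiv> max_rel_deg E w m"
abbreviation \<Delta> :: "('v \<Rightarrow> real) \<Rightarrow> 'v \<Rightarrow> real" where "\<Delta> \<equiv> laplacian E w m"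

lemma weighted_deg_nonneg: "0 \<le> weighted_deg E w x"
  unfolding weighted_deg_def by (intro sum_nonneg weight_nonneg)

lemma rel_deg_le: "weighted_deg E w x / m x \<le> D"
  unfolding max_rel_deg_def by (rule cSUP_upper[OF _ rel_deg_bounded]) simp

lemma D_nonneg: "0 \<le> D"
  using order_trans[OF _ rel_deg_le] weighted_deg_nonneg measure_pos
  by (meson divide_nonneg_pos)

lemma weighted_deg_le: "weighted_deg E w x \<le> D * m x"
  using rel_deg_le[of x] measure_pos[of x] by (simp add: field_simps)

lemma weight_eq_0: "(x, y) \<notin> E \<Longrightarrow> w x y = 0"
  using weight_pos_iff[of x y] weight_nonneg[of x y] by force

lemma edge_sym: "(x, y) \<in> E \<longleftrightarrow> (y, x) \<in> E"
  using weight_pos_iff weight_sym by metis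

lemma sum_neighbours:
  assumes "finite S" "E `` {x} \<subseteq> S"
  shows "(\<Sum>y\<in>E `` {x}. w x y * h y) = (\<Sum>y\<in>S. w x y * h y)"
  by (rule sum.mono_neutral_left) (use assms weight_eq_0 in auto)

lemma sum_weight_le:
  assumes "finite F"
  shows "(\<Sum>y\<in>F. w x y) \<le> weighted_deg E w x"
proof -
  have "(\<Sum>y\<in>F. w x y) = (\<Sum>y\<in>F \<inter> E `` {x}. w x y)"
    by (rule sum.mono_neutral_right) (use assms weight_eq_0 in auto)
  also have "\<dots> \<le> weighted_deg E w x"
    unfolding weighted_deg_def
    by (rule sum_mono2) (use locally_finite weight_nonneg in auto)
  finally show ?thesis .
qed

lemma laplacian_diff: "\<Delta> (\<lambda>z. f z - c * g z) x = \<Delta> f x - c * \<Delta> g x"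
  by (simp add: laplacian_def right_diff_distrib sum_subtractf diff_divide_distrib sum_distrib_left
      mult.left_commute)

definition gen :: "('v \<Rightarrow> real) \<Rightarrow> 'v \<Rightarrow> real" where
  "gen g x = D * g x + \<Delta> g x"

text \<open>All coefficients are nonnegative, the diagonal one by \<open>rel_deg_le\<close>, and the
  sum is finite. Positivity, locality and the passage of pointwise convergent series through
  \<open>gen\<close> come from this form.\<close>

lemma gen_eq: "gen g x = (\<Sum>y\<in>E `` {x}. w x y / m x * g y) + (D - weighted_deg E w x / m x) * g x"
  by (simp add: gen_def laplacian_def weighted_deg_def right_diff_distrib sum_subtractf
      sum_distrib_left sum_distrib_right sum_divide_distrib left_diff_distrib)

lemma gen_cong:
  assumes "\<And>y. y \<in> insert x (E `` {x}) \<Longrightarrow> g y = h y"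
  shows "gen g x = gen h x"
  unfolding gen_eq using assms by (intro arg_cong2[where f = "(+)"] sum.cong) auto

lemma gen_abs_le: "\<bar>gen g x\<bar> \<le> gen (\<lambda>z. \<bar>g z\<bar>) x"
proof -
  have "\<bar>\<Sum>y\<in>E `` {x}. w x y / m x * g y\<bar> \<le> (\<Sum>y\<in>E `` {x}. w x y / m x * \<bar>g y\<bar>)"
    by (rule order_trans[OF sum_abs])
      (use weight_nonneg measure_pos[of x] in \<open>auto simp: abs_mult intro!: sum_mono\<close>)
  moreover have "\<bar>(D - weighted_deg E w x / m x) * g x\<bar> = (D - weighted_deg E w x / m x) * \<bar>g x\<bar>"
    using rel_deg_le[of x] by (simp add: abs_mult)
  ultimately show ?thesis unfolding gen_eq by linarith
qed

lemma gen_mono: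
  assumes "\<And>z. g z \<le> h z"
  shows "gen g x \<le> gen h x"
  unfolding gen_eq using rel_deg_le[of x] weight_nonneg measure_pos[of x] assms
  by (intro add_mono sum_mono mult_left_mono) (auto intro!: divide_nonneg_pos)

lemma gen_add: "gen (\<lambda>z. g z + h z) x = gen g x + gen h x"
  by (simp add: gen_eq distrib_left sum.distrib)

lemma gen_cmult: "gen (\<lambda>z. c * g z) x = c * gen g x"
  by (simp add: gen_eq distrib_left sum_distrib_left mult.left_commute)

lemma gen_const: "gen (\<lambda>z. c) x = D * c"
  by (simp add: gen_def laplacian_def)

lemma gen_sums:
  assumes "\<And>z. (\<lambda>k. a k z) sums s z"
  shows "(\<lambda>k. gen (a k) x) sums gen s x"
  unfolding gen_eq using assms by (intro sums_add sums_sum sums_mult)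

lemma gen_has_sum:
  assumes "\<And>z. ((\<lambda>k. a k z) has_sum s z) A"
  shows "((\<lambda>k. gen (a k) x) has_sum gen s x) A"
  unfolding gen_eq using assms by (intro has_sum_add has_sum_finite_sum has_sum_cmult_right)

section \<open>Iterates of the shifted Laplacian and their growth\<close>

lemma geniter_Suc_right: "(gen ^^ Suc k) g = (gen ^^ k) (gen g)"
  by (simp add: funpow_swap1)

lemma geniter_abs_le: "\<bar>(gen ^^ k) g x\<bar> \<le> (gen ^^ k) (\<lambda>z. \<bar>g z\<bar>) x"
proof (induction k arbitrary: x)
  case (Suc k)
  show ?case
    using order_trans[OF gen_abs_le gen_mono[OF Suc.IH]] by simp
qed simp

lemma geniter_mono:
  assumes "\<And>z. g z \<le> h z"
  shows "(gen ^^ k) g x \<le> (gen ^^ k) h x"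
  using assms by (induction k arbitrary: x) (auto intro: gen_mono)

lemma geniter_add: "(gen ^^ k) (\<lambda>z. g z + h z) x = (gen ^^ k) g x + (gen ^^ k) h x"
proof (induction k arbitrary: x)
  case (Suc k)
  have "(gen ^^ k) (\<lambda>z. g z + h z) = (\<lambda>z. (gen ^^ k) g z + (gen ^^ k) h z)"
    using Suc.IH by blast
  then show ?case by (simp add: gen_add)
qed simp

lemma geniter_cmult: "(gen ^^ k) (\<lambda>z. c * g z) x = c * (gen ^^ k) g x"
proof (induction k arbitrary: x)
  case (Suc k)
  have "(gen ^^ k) (\<lambda>z. c * g z) = (\<lambda>z. c * (gen ^^ k) g z)"
    using Suc.IH by blast
  then show ?case by (simp add: gen_cmult)
qed simp

lemma geniter_const: "(gen ^^ k) (\<lambda>z. c) x = D ^ k * c"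
proof (induction k arbitrary: x)
  case (Suc k)
  have "(gen ^^ k) (\<lambda>z. c) = (\<lambda>z. D ^ k * c)"
    using Suc.IH by blast
  then show ?case by (simp add: gen_const)
qed simp

lemma geniter_nonneg:
  assumes "\<And>z. 0 \<le> g z"
  shows "0 \<le> (gen ^^ k) g x"
  using geniter_mono[of "\<lambda>z. 0" g k x] assms by (simp add: geniter_const)

lemma geniter_has_sum:
  assumes "\<And>z. ((\<lambda>k. a k z) has_sum s z) A"
  shows "((\<lambda>k. (gen ^^ j) (a k) x) has_sum (gen ^^ j) s x) A"
  using assms by (induction j arbitrary: x) (auto intro: gen_has_sum)

text \<open>For \<open>f\<close> in any \<open>\<ell>\<^sup>p\<close> the exponential series of \<open>gen\<close> applied to \<open>f\<close> converges pointwise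
  absolutely because of this property; no operator norm on \<open>\<ell>\<^sup>p\<close> is needed.\<close>

definition tame :: "('v \<Rightarrow> real) \<Rightarrow> bool" where
  "tame g \<longleftrightarrow> (\<forall>x. \<exists>B. \<forall>k. (gen ^^ k) (\<lambda>z. \<bar>g z\<bar>) x \<le> B * D ^ k)"

lemma tameE:
  assumes "tame g"
  obtains B where "0 \<le> B" "\<And>k. (gen ^^ k) (\<lambda>z. \<bar>g z\<bar>) x \<le> B * D ^ k"
proof -
  obtain B where B: "\<And>k. (gen ^^ k) (\<lambda>z. \<bar>g z\<bar>) x \<le> B * D ^ k"
    using assms unfolding tame_def by blast
  moreover have "0 \<le> B" using B[of 0] by simp
  ultimately show ?thesis using that by blast
qed

lemma tame_mono:
  assumes "tame h" "\<And>z. \<bar>g z\<bar> \<le> \<bar>h z\<bar>"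
  shows "tame g"
  unfolding tame_def
proof
  fix x
  obtain B where "\<And>k. (gen ^^ k) (\<lambda>z. \<bar>h z\<bar>) x \<le> B * D ^ k"
    using assms(1) by (metis tameE)
  then show "\<exists>B. \<forall>k. (gen ^^ k) (\<lambda>z. \<bar>g z\<bar>) x \<le> B * D ^ k"
    using order_trans[OF geniter_mono[of "\<lambda>z. \<bar>g z\<bar>" "\<lambda>z. \<bar>h z\<bar>", OF assms(2)]] by blast
qed

lemma tame_abs: "tame g \<Longrightarrow> tame (\<lambda>z. \<bar>g z\<bar>)"
  by (erule tame_mono) simp

lemma tame_const: "tame (\<lambda>z. c)"
  unfolding tame_def using geniter_const[of _ "\<bar>c\<bar>"] by (metis mult.commute order_refl)

lemma tame_add:
  assumes "tame g" "tame h"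
  shows "tame (\<lambda>z. g z + h z)"
  unfolding tame_def
proof
  fix x
  obtain B C where B: "\<And>k. (gen ^^ k) (\<lambda>z. \<bar>g z\<bar>) x \<le> B * D ^ k"
    and C: "\<And>k. (gen ^^ k) (\<lambda>z. \<bar>h z\<bar>) x \<le> C * D ^ k"
    using assms by (metis tameE)
  have "(gen ^^ k) (\<lambda>z. \<bar>g z + h z\<bar>) x \<le> (B + C) * D ^ k" for k
  proof -
    have "(gen ^^ k) (\<lambda>z. \<bar>g z + h z\<bar>) x \<le> (gen ^^ k) (\<lambda>z. \<bar>g z\<bar> + \<bar>h z\<bar>) x"
      by (rule geniter_mono) simp
    also have "\<dots> \<le> (B + C) * D ^ k"
      using B[of k] C[of k] by (simp add: geniter_add distrib_right)
    finally show ?thesis .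
  qed
  then show "\<exists>B. \<forall>k. (gen ^^ k) (\<lambda>z. \<bar>g z + h z\<bar>) x \<le> B * D ^ k" by blast
qed

text \<open>\<open>gen\<close> has norm at most \<open>D\<close> on l^1(V, m): by symmetry of
  \<open>w\<close>, the value \<open>g y\<close> is weighted by at most the degree of
  \<open>y\<close> from neighbours plus \<open>D * m y\<close> minus that degree from the diagonal.
  Bounding finite partial sums avoids any prior summability claim about
  \<open>gen g\<close>.\<close>

lemma sum_gen_le:
  assumes nonneg: "\<And>z. 0 \<le> g z"
    and bound: "\<And>F. finite F \<Longrightarrow> (\<Sum>x\<in>F. m x * g x) \<le> A"
    and F: "finite F"
  shows "(\<Sum>x\<in>F. m x * gen g x) \<le> D * A"
proof -
  \<comment> \<open>\<open>S\<close> contains all neighbours of \<open>F\<close>, so every row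
    becomes a sum over the same finite set.\<close>
  define S where "S = F \<union> (\<Union>x\<in>F. E `` {x})"
  have S: "finite S" "F \<subseteq> S" "\<And>x. x \<in> F \<Longrightarrow> E `` {x} \<subseteq> S"
    unfolding S_def using F locally_finite by auto
  note deg = sum_weight_le[OF F]
  have "(\<Sum>x\<in>F. m x * gen g x)
      = (\<Sum>x\<in>F. (\<Sum>y\<in>S. w x y * g y) + (D * m x - weighted_deg E w x) * g x)"
  proof (rule sum.cong[OF refl])
    fix x assume "x \<in> F"
    have "m x * gen g x = (\<Sum>y\<in>E `` {x}. w x y * g y) + (D * m x - weighted_deg E w x) * g x"
      using measure_pos[of x] by (simp add: gen_eq sum_distrib_left field_simps)
    then show "m x * gen g x = (\<Sum>y\<in>S. w x y * g y) + (D * m x - weighted_deg E w x) * g x"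
      using sum_neighbours[OF S(1) S(3)[OF \<open>x \<in> F\<close>]] by simp
  qed
  also have "\<dots> = (\<Sum>y\<in>S. \<Sum>x\<in>F. w y x * g y) + (\<Sum>x\<in>F. (D * m x - weighted_deg E w x) * g x)"
    by (subst sum.swap) (simp add: sum.distrib weight_sym)
  \<comment> \<open>Column sums over \<open>F\<close> are at most the degree, and the diagonal terms
    added in passing from \<open>F\<close> to \<open>S\<close> are nonnegative.\<close>
  also have "\<dots> \<le> (\<Sum>y\<in>S. weighted_deg E w y * g y) + (\<Sum>x\<in>S. (D * m x - weighted_deg E w x) * g x)"
    using deg nonneg weighted_deg_le S
    by (intro add_mono sum_mono sum_mono2) (auto simp: sum_distrib_right[symmetric] intro: mult_right_mono)
  also have "\<dots> = D * (\<Sum>x\<in>S. m x * g x)"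
    by (simp add: sum.distrib[symmetric] sum_distrib_left algebra_simps)
  also have "\<dots> \<le> D * A"
    using bound[OF S(1)] D_nonneg by (rule mult_left_mono)
  finally show ?thesis .
qed

lemma sum_geniter_le:
  assumes "\<And>z. 0 \<le> g z"
    and "\<And>F. finite F \<Longrightarrow> (\<Sum>x\<in>F. m x * g x) \<le> A"
    and "finite F"
  shows "(\<Sum>x\<in>F. m x * (gen ^^ k) g x) \<le> D ^ k * A"
  using assms(3)
proof (induction k arbitrary: F)
  case (Suc k)
  then show ?case
    using sum_gen_le[of "(gen ^^ k) g" "D ^ k * A" F] geniter_nonneg[OF assms(1)] by simp
qed (use assms in simp)

text \<open>The mass bound on the one-point set \<open>{x}\<close> reads
  \<open>m x * (gen ^^ k) g x \<le> D ^ k * A\<close>, so \<open>A / m x\<close> serves as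
  \<open>B\<close>.\<close>

lemma tame_summable:
  assumes "\<And>z. 0 \<le> g z" "(\<lambda>x. g x * m x) summable_on UNIV"
  shows "tame g"
  unfolding tame_def
proof
  fix x
  define A where "A = (\<Sum>\<^sub>\<infinity>x. g x * m x)"
  have A: "(\<Sum>x\<in>F. m x * g x) \<le> A" if "finite F" for F
    using finite_sum_le_infsum[OF assms(2) that] assms(1) measure_pos[THEN less_imp_le]
    by (simp add: A_def mult.commute)
  have "(gen ^^ k) g x \<le> A / m x * D ^ k" for k
    using sum_geniter_le[OF assms(1) A, of "{x}" k] measure_pos[of x]
    by (simp add: field_simps)
  then show "\<exists>B. \<forall>k. (gen ^^ k) (\<lambda>z. \<bar>g z\<bar>) x \<le> B * D ^ k"
    using assms(1) by (intro exI[of _ "A / m x"]) simp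
qed

text \<open>Tameness passes to sums and to dominated functions, and holds for constants and for
  nonnegative functions of finite mass; for finite \<open>p\<close>, 1 + |f|^p is a sum of these two
  kinds.\<close>

lemma tame_lp_space:
  assumes "f \<in> lp_space m p" "1 \<le> p"
  shows "tame f"
proof (cases "p = \<infinity>")
  case True
  then obtain c where "\<And>x. \<bar>f x\<bar> \<le> c"
    using assms by (auto simp: lp_space_def bounded_iff)
  then show ?thesis
    by (intro tame_mono[OF tame_const[of c]]) (metis abs_ge_self order_trans)
next
  case False
  define q where "q = real_of_ereal p"
  have q: "1 \<le> q" using assms(2) False unfolding q_def by (cases p) auto
  have "tame (\<lambda>x. 1 + \<bar>f x\<bar> powr q)"
    using assms(1) False
    by (intro tame_add tame_const tame_summable) (auto simp: lp_space_def q_def)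
  moreover have "\<bar>f x\<bar> \<le> 1 + \<bar>f x\<bar> powr q" for x
  proof (cases "\<bar>f x\<bar> \<le> 1")
    case False
    then show ?thesis using powr_mono[OF q, of "\<bar>f x\<bar>"] by simp
  qed (simp add: add_increasing2)
  ultimately show ?thesis
    by (intro tame_mono[of "\<lambda>x. 1 + \<bar>f x\<bar> powr q" f]) (auto intro: order_trans[OF _ abs_ge_self])
qed

lemma tame_finite_support:
  assumes "finite S" "\<And>x. x \<notin> S \<Longrightarrow> g x = 0"
  shows "tame g"
proof (rule tame_mono[OF tame_const])
  fix z
  show "\<bar>g z\<bar> \<le> \<bar>\<Sum>x\<in>S. \<bar>g x\<bar>\<bar>"
    using assms member_le_sum[of z S "\<lambda>x. \<bar>g x\<bar>"] by (cases "z \<in> S") (auto intro: sum_nonneg)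
qed

end

section \<open>The heat semigroup as an exponential series\<close>

lemma summable_exp_dominated:
  fixes a :: "nat \<Rightarrow> real"
  assumes "\<And>k. \<bar>a k\<bar> \<le> B * d ^ k"
  shows "summable (\<lambda>k. \<bar>t ^ k / fact k * a k\<bar>)"
proof (rule summable_comparison_test')
  have "summable (\<lambda>k. inverse (fact k) * (\<bar>t\<bar> * d) ^ k)"
    by (rule summable_exp)
  then show "summable (\<lambda>k. B * (inverse (fact k) * (\<bar>t\<bar> * d) ^ k))"
    by (rule summable_mult)
  fix k
  have "\<bar>t ^ k / fact k\<bar> * \<bar>a k\<bar> \<le> \<bar>t ^ k / fact k\<bar> * (B * d ^ k)"
    by (rule mult_left_mono) (use assms in auto)
  also have "\<bar>t ^ k / fact k\<bar> = inverse (fact k) * \<bar>t\<bar> ^ k"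
    by (simp add: power_abs[symmetric] abs_mult divide_inverse_commute)
  finally show "norm \<bar>t ^ k / fact k * a k\<bar> \<le> B * (inverse (fact k) * (\<bar>t\<bar> * d) ^ k)"
    by (simp add: abs_mult power_abs power_mult_distrib divide_inverse mult_ac)
qed

text \<open>The binomial theorem divided by \<open>fact n\<close>; it recombines the diagonals of a
  product of two exponential series.\<close>

lemma exp_power_add: "(s + t :: real) ^ n / fact n = (\<Sum>i\<le>n. s ^ i / fact i * (t ^ (n - i) / fact (n - i)))"
proof -
  have eq: "z ^ k /\<^sub>R fact k = z ^ k / fact k" for z :: real and k
    unfolding real_scaleR_def divide_inverse by (rule mult.commute)
  show ?thesis
    using exp_series_add_commuting[of s t n, OF mult.commute] unfolding eq .
qed

lemma abs_mult_le: "0 \<le> c \<Longrightarrow> \<bar>z\<bar> \<le> b \<Longrightarrow> \<bar>c * z\<bar> \<le> c * b" for c :: real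
  by (simp add: abs_mult mult_left_mono)

lemma exhaustion_eventually_mem:
  assumes "exhaustion \<Omega>"
  shows "\<forall>\<^sub>F i in sequentially. x \<in> \<Omega> i"
proof -
  have inc: "incseq \<Omega>" and "(\<Union>i. \<Omega> i) = UNIV"
    using assms by (simp_all add: exhaustion_def)
  then obtain j where "x \<in> \<Omega> j" by blast
  with inc show ?thesis
    unfolding eventually_sequentially incseq_def by blast
qed

context weighted_graph
begin

text \<open>The cutoff after every step encodes the Dirichlet condition; with \<open>UNIV\<close>
  the same recursion gives the free iterates, so both flows share one series.\<close>

primrec diter :: "'v set \<Rightarrow> ('v \<Rightarrow> real) \<Rightarrow> nat \<Rightarrow> 'v \<Rightarrow> real" where
  "diter \<Omega> g 0 = (\<lambda>x. if x \<in> \<Omega> then g x else 0)"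
| "diter \<Omega> g (Suc k) = (\<lambda>x. if x \<in> \<Omega> then gen (diter \<Omega> g k) x else 0)"

lemma diter_UNIV: "diter UNIV g k = (gen ^^ k) g"
  by (induction k) auto

lemma diter_outside: "x \<notin> \<Omega> \<Longrightarrow> diter \<Omega> g k x = 0"
  by (cases k) auto

text \<open>A cutoff only discards terms of a positive operator, so the majorant is independent of
  \<Omega>. This uniformity allows dominated convergence along exhaustions.\<close>

lemma diter_abs_le: "\<bar>diter \<Omega> g k x\<bar> \<le> (gen ^^ k) (\<lambda>z. \<bar>g z\<bar>) x"
proof (induction k arbitrary: x)
  case (Suc k)
  have "\<bar>gen (diter \<Omega> g k) x\<bar> \<le> gen (\<lambda>z. \<bar>diter \<Omega> g k z\<bar>) x"
    by (rule gen_abs_le)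
  also have "\<dots> \<le> (gen ^^ Suc k) (\<lambda>z. \<bar>g z\<bar>) x"
    using gen_mono[OF Suc.IH] by simp
  finally have "\<bar>gen (diter \<Omega> g k) x\<bar> \<le> (gen ^^ Suc k) (\<lambda>z. \<bar>g z\<bar>) x" .
  moreover have "0 \<le> (gen ^^ Suc k) (\<lambda>z. \<bar>g z\<bar>) x"
    by (rule geniter_nonneg) simp
  ultimately show ?case
    by (cases "x \<in> \<Omega>") (simp_all del: funpow.simps)
qed simp

lemma diter_abs_bound:
  assumes "tame g"
  obtains B where "0 \<le> B" "\<And>\<Omega> k. \<bar>diter \<Omega> g k x\<bar> \<le> B * D ^ k"
proof -
  obtain B where "0 \<le> B" and B: "\<And>k. (gen ^^ k) (\<lambda>z. \<bar>g z\<bar>) x \<le> B * D ^ k"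
    by (rule tameE[OF assms, where x = x]) (rule that)
  then show ?thesis using that order_trans[OF diter_abs_le B] by blast
qed

text \<open>The series \<open>e\<^bsup>-Dt\<^esup> \<Sum> t\<^sup>k/k! (\<one>\<^sub>\<Omega> gen)\<^sup>k \<one>\<^sub>\<Omega> g\<close> for \<open>e\<^bsup>t\<Delta>\<^esup>\<close> with Dirichlet condition off
  \<open>\<Omega>\<close>; splitting off \<open>D\<close> leaves a positive operator.\<close>

definition heat :: "'v set \<Rightarrow> ('v \<Rightarrow> real) \<Rightarrow> real \<Rightarrow> 'v \<Rightarrow> real" where
  "heat \<Omega> g t x = exp (- (D * t)) * (\<Sum>k. t ^ k / fact k * diter \<Omega> g k x)"

lemma heat_summable:
  assumes "tame g"
  shows "summable (\<lambda>k. \<bar>t ^ k / fact k * diter \<Omega> g k x\<bar>)"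
proof -
  obtain B where "0 \<le> B" and B: "\<And>\<Omega> k. \<bar>diter \<Omega> g k x\<bar> \<le> B * D ^ k"
    by (rule diter_abs_bound[OF assms, where x = x]) (rule that)
  from B show ?thesis by (rule summable_exp_dominated)
qed

lemma heat_sums:
  assumes "tame g"
  shows "(\<lambda>k. exp (- (D * t)) * (t ^ k / fact k) * diter \<Omega> g k x) sums heat \<Omega> g t x"
  unfolding heat_def mult.assoc
  by (rule sums_mult, rule summable_sums, rule summable_rabs_cancel, rule heat_summable, rule assms)

lemma heat_has_sum:
  assumes "tame g"
  shows "((\<lambda>k. exp (- (D * t)) * (t ^ k / fact k) * diter \<Omega> g k x) has_sum heat \<Omega> g t x) UNIV"
proof (rule norm_summable_imp_has_sum[OF _ heat_sums[OF assms]])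
  have "norm (exp (- (D * t)) * (t ^ k / fact k) * diter \<Omega> g k x)
      = exp (- (D * t)) * \<bar>t ^ k / fact k * diter \<Omega> g k x\<bar>" for k
    unfolding mult.assoc real_norm_def by (subst abs_mult) simp
  then show "summable (\<lambda>k. norm (exp (- (D * t)) * (t ^ k / fact k) * diter \<Omega> g k x))"
    using summable_mult[OF heat_summable[OF assms], of "exp (- (D * t))" t \<Omega> x] by (simp only:)
qed

lemma heat_0: "x \<in> \<Omega> \<Longrightarrow> heat \<Omega> g 0 x = g x"
proof -
  assume x: "x \<in> \<Omega>"
  \<comment> \<open>Only the term at k = 0 survives, with \<open>0 ^ 0 = 1\<close>.\<close>
  have "(\<lambda>k. 0 ^ k / fact k * diter \<Omega> g k x) sums (\<Sum>k\<in>{0}. 0 ^ k / fact k * diter \<Omega> g k x)"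
    by (rule sums_finite) auto
  then show ?thesis using x by (simp add: heat_def sums_iff)
qed

lemma heat_outside: "x \<notin> \<Omega> \<Longrightarrow> heat \<Omega> g t x = 0"
  by (simp add: heat_def diter_outside)

text \<open>The series is an everywhere convergent power series in time. Termwise differentiation
  shifts the index, which applies \<open>gen\<close> once more because
  \<open>x \<in> \<Omega>\<close>; the exponential prefactor contributes \<open>- D\<close>, and
  \<open>gen\<close> minus \<open>D\<close> is \<Delta>.\<close>

lemma heat_deriv:
  assumes "tame g" "x \<in> \<Omega>"
  shows "((\<lambda>s. heat \<Omega> g s x) has_real_derivative \<Delta> (heat \<Omega> g t) x) (at t)"
proof -
  define c where "c k = diter \<Omega> g k x / fact k" for k
  have cs: "t ^ k / fact k * diter \<Omega> g k x = c k * t ^ k" for k t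
    by (simp add: c_def)
  have "summable (\<lambda>k. c k * y ^ k)" for y
    using summable_rabs_cancel[OF heat_summable[OF assms(1), of y \<Omega> x]] by (simp only: cs)
  then have d: "((\<lambda>y. \<Sum>k. c k * y ^ k) has_real_derivative (\<Sum>k. diffs c k * t ^ k)) (at t)"
    by (rule termdiffs_strong_converges_everywhere)
  \<comment> \<open>The factor \<open>Suc k\<close> introduced by \<open>diffs\<close> turns
    \<open>fact (Suc k)\<close> into \<open>fact k\<close>.\<close>
  have diffs: "diffs c k = diter \<Omega> g (Suc k) x / fact k" for k
    by (simp add: diffs_def c_def del: of_nat_Suc diter.simps)
  have "(\<lambda>k. gen (\<lambda>z. exp (- (D * t)) * (t ^ k / fact k) * diter \<Omega> g k z) x) sums gen (heat \<Omega> g t) x"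
    by (rule gen_sums) (rule heat_sums[OF assms(1)])
  then have "(\<lambda>k. exp (- (D * t)) * (diffs c k * t ^ k)) sums gen (heat \<Omega> g t) x"
    unfolding gen_cmult diffs using assms(2) by (simp add: mult_ac)
  from sums_mult[OF this, of "exp (D * t)"]
  have "(\<lambda>k. diffs c k * t ^ k) sums (exp (D * t) * gen (heat \<Omega> g t) x)"
    by (simp add: mult.assoc[symmetric] exp_minus)
  then have s: "exp (- (D * t)) * (\<Sum>k. diffs c k * t ^ k) = gen (heat \<Omega> g t) x"
    by (simp add: sums_iff exp_minus)
  have "((\<lambda>y. exp (- (D * y)) * (\<Sum>k. c k * y ^ k)) has_real_derivative
      exp (- (D * t)) * (\<Sum>k. diffs c k * t ^ k) - D * (exp (- (D * t)) * (\<Sum>k. c k * t ^ k))) (at t)"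
    by (rule derivative_eq_intros d refl | simp)+
  moreover have "exp (- (D * y)) * (\<Sum>k. c k * y ^ k) = heat \<Omega> g y x" for y
    by (simp only: heat_def cs)
  ultimately show ?thesis
    unfolding s by (simp add: gen_def)
qed

text \<open>\<open>gen\<close> at \<open>x\<close> reads only \<open>x\<close> and its finitely many
  neighbours, so after \<open>k\<close> steps the cutoffs are invisible once the set contains a
  large enough ball about \<open>x\<close>.\<close>

lemma diter_exhaustion:
  assumes "exhaustion \<Omega>"
  shows "\<forall>\<^sub>F i in sequentially. diter (\<Omega> i) g k x = (gen ^^ k) g x"
proof (induction k arbitrary: x)
  case 0
  show ?case using exhaustion_eventually_mem[OF assms, of x] by eventually_elim simp
next
  case (Suc k)
  have "\<forall>\<^sub>F i in sequentially. \<forall>y\<in>insert x (E `` {x}). diter (\<Omega> i) g k y = (gen ^^ k) g y"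
    by (rule eventually_ball_finite) (use locally_finite Suc.IH in auto)
  then show ?case
    using exhaustion_eventually_mem[OF assms, of x] by eventually_elim (auto intro: gen_cong)
qed

text \<open>Dominated convergence for series (Tannery): each term is eventually constant along the
  exhaustion, and the bound \<open>B * D ^ k\<close> does not depend on the set.\<close>

lemma heat_exhaustion:
  assumes "exhaustion \<Omega>" "tame g"
  shows "(\<lambda>i. heat (\<Omega> i) g t x) \<longlonglongrightarrow> heat UNIV g t x"
proof -
  obtain B where B: "0 \<le> B" "\<And>\<Omega> k. \<bar>diter \<Omega> g k x\<bar> \<le> B * D ^ k"
    by (rule diter_abs_bound[OF assms(2), where x = x]) (rule that)
  have "(\<lambda>i. \<Sum>k. t ^ k / fact k * diter (\<Omega> i) g k x) \<longlonglongrightarrow> (\<Sum>k. t ^ k / fact k * diter UNIV g k x)"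
  proof (rule tannerys_theorem[THEN conjunct2, THEN conjunct2])
    show "\<forall>\<^sub>F (k, n) in at_top \<times>\<^sub>F sequentially.
        norm (t ^ k / fact k * diter (\<Omega> n) g k x) \<le> \<bar>t ^ k / fact k * (B * D ^ k)\<bar>"
    proof (intro always_eventually, simp only: split_paired_All prod.case, intro allI)
      fix k n
      show "norm (t ^ k / fact k * diter (\<Omega> n) g k x) \<le> \<bar>t ^ k / fact k * (B * D ^ k)\<bar>"
        unfolding abs_mult real_norm_def
        by (intro mult_left_mono order_trans[OF B(2)]) (simp_all add: abs_mult[symmetric])
    qed
    show "summable (\<lambda>k. \<bar>t ^ k / fact k * (B * D ^ k)\<bar>)"
      using B(1) D_nonneg by (intro summable_exp_dominated[of _ B D]) simp
    show "(\<lambda>n. t ^ k / fact k * diter (\<Omega> n) g k x) \<longlonglongrightarrow> t ^ k / fact k * diter UNIV g k x" for k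
      unfolding diter_UNIV
      by (intro tendsto_mult_left tendsto_eventually diter_exhaustion assms(1))
  qed simp
  then show ?thesis unfolding heat_def by (rule tendsto_mult_left)
qed

section \<open>Semigroup law of the free heat flow\<close>

lemma geniter_heat_has_sum:
  assumes "tame g"
  shows "((\<lambda>k. exp (- (D * t)) * (t ^ k / fact k) * (gen ^^ (j + k)) g x) has_sum
    (gen ^^ j) (heat UNIV g t) x) UNIV"
proof -
  have "((\<lambda>k. (gen ^^ j) (\<lambda>z. exp (- (D * t)) * (t ^ k / fact k) * diter UNIV g k z) x) has_sum
    (gen ^^ j) (heat UNIV g t) x) UNIV"
    by (intro geniter_has_sum heat_has_sum assms)
  then show ?thesis by (simp only: geniter_cmult diter_UNIV funpow_add o_apply)
qed

text \<open>These are the Poisson weights with parameter \<open>D * t\<close>; their normalization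
  preserves the constant in the tameness bound under the flow.\<close>

lemma exp_D_has_sum: "((\<lambda>k. exp (- (D * t)) * (t ^ k / fact k) * D ^ k) has_sum 1) UNIV"
proof -
  have "(\<lambda>k. (D * t) ^ k / fact k) sums exp (D * t)"
    using exp_converges[of "D * t"] by (simp add: scaleR_conv_of_real field_simps)
  from norm_summable_imp_has_sum[OF _ this]
  have "((\<lambda>k. (D * t) ^ k / fact k) has_sum exp (D * t)) UNIV"
    using summable_norm_exp[of "D * t"] by (simp add: scaleR_conv_of_real field_simps abs_mult)
  from has_sum_cmult_right[OF this, of "exp (- (D * t))"] show ?thesis
    by (simp add: exp_minus power_mult_distrib mult_ac)
qed

lemma heat_abs_le:
  assumes "tame g" "0 \<le> t"
  shows "\<bar>heat UNIV g t x\<bar> \<le> heat UNIV (\<lambda>z. \<bar>g z\<bar>) t x"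
proof -
  have "\<bar>exp (- (D * t)) * (t ^ k / fact k) * diter UNIV g k x\<bar>
      \<le> exp (- (D * t)) * (t ^ k / fact k) * diter UNIV (\<lambda>z. \<bar>g z\<bar>) k x" for k
    unfolding diter_UNIV using assms(2) geniter_abs_le by (intro abs_mult_le) auto
  then have "\<bar>\<Sum>k. exp (- (D * t)) * (t ^ k / fact k) * diter UNIV g k x\<bar>
      \<le> (\<Sum>k. exp (- (D * t)) * (t ^ k / fact k) * diter UNIV (\<lambda>z. \<bar>g z\<bar>) k x)"
    by (rule norm_suminf_le[where 'a = real, unfolded real_norm_def,
          OF _ sums_summable[OF heat_sums[OF tame_abs[OF assms(1)]]]])
  then show ?thesis
    unfolding sums_unique[OF heat_sums[OF assms(1)], symmetric]
      sums_unique[OF heat_sums[OF tame_abs[OF assms(1)]], symmetric] .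
qed

text \<open>The same \<open>B\<close> works at every time: the iterate of order \<open>j + k\<close>
  is at most \<open>B * D ^ (j + k)\<close>, and averaging with Poisson weights leaves
  \<open>B * D ^ j\<close>. This permits restarting the flow from a later time.\<close>

lemma tame_heat:
  assumes "tame g" "0 \<le> t"
  shows "tame (heat UNIV g t)"
  unfolding tame_def
proof
  fix x
  obtain B where B: "0 \<le> B" "\<And>k. (gen ^^ k) (\<lambda>z. \<bar>g z\<bar>) x \<le> B * D ^ k"
    by (rule tameE[OF assms(1), where x = x]) (rule that)
  have "(gen ^^ j) (\<lambda>z. \<bar>heat UNIV g t z\<bar>) x \<le> B * D ^ j" for j
  proof -
    have "(gen ^^ j) (\<lambda>z. \<bar>heat UNIV g t z\<bar>) x \<le> (gen ^^ j) (heat UNIV (\<lambda>z. \<bar>g z\<bar>) t) x"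
      using heat_abs_le assms by (intro geniter_mono) auto
    also have "\<dots> \<le> B * D ^ j * 1"
    proof (rule has_sum_mono[OF geniter_heat_has_sum has_sum_cmult_right[OF exp_D_has_sum[of t]]])
      fix k
      have "exp (- (D * t)) * (t ^ k / fact k) * (gen ^^ (j + k)) (\<lambda>z. \<bar>g z\<bar>) x
          \<le> exp (- (D * t)) * (t ^ k / fact k) * (B * D ^ (j + k))"
        using assms(2) B(2) by (intro mult_left_mono) auto
      then show "exp (- (D * t)) * (t ^ k / fact k) * (gen ^^ (j + k)) (\<lambda>z. \<bar>g z\<bar>) x
          \<le> B * D ^ j * (exp (- (D * t)) * (t ^ k / fact k) * D ^ k)"
        by (simp add: power_add mult_ac)
    qed (use assms(1) in \<open>rule tame_abs\<close>)
    finally show ?thesis by simp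
  qed
  then show "\<exists>B. \<forall>j. (gen ^^ j) (\<lambda>z. \<bar>heat UNIV g t z\<bar>) x \<le> B * D ^ j" by blast
qed

text \<open>Both flows are expanded into one absolutely convergent double series, which is collected
  along the diagonals \<open>j + k = n\<close> and evaluated by the binomial theorem.\<close>

lemma heat_heat:
  assumes g: "tame g" and "0 \<le> s" "0 \<le> t"
  shows "heat UNIV (heat UNIV g s) t x = heat UNIV g (s + t) x"
proof -
  define a where "a j k = exp (- (D * t)) * (t ^ j / fact j) *
    (exp (- (D * s)) * (s ^ k / fact k) * (gen ^^ (j + k)) g x)" for j k
  define a' where "a' j k = exp (- (D * t)) * (t ^ j / fact j) *
    (exp (- (D * s)) * (s ^ k / fact k) * (gen ^^ (j + k)) (\<lambda>z. \<bar>g z\<bar>) x)" for j k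
  have inner: "((\<lambda>k. exp (- (D * s)) * (s ^ k / fact k) * (gen ^^ (j + k)) h x) has_sum
      (gen ^^ j) (heat UNIV h s) x) UNIV" if "tame h" for h j
    using that by (rule geniter_heat_has_sum)
  have rows: "(a j has_sum exp (- (D * t)) * (t ^ j / fact j) * (gen ^^ j) (heat UNIV g s) x) UNIV" for j
    unfolding a_def by (intro has_sum_cmult_right inner g)
  have rows': "(a' j has_sum exp (- (D * t)) * (t ^ j / fact j) * (gen ^^ j) (heat UNIV (\<lambda>z. \<bar>g z\<bar>) s) x) UNIV" for j
    unfolding a'_def by (intro has_sum_cmult_right inner tame_abs g)
  have total: "((\<lambda>j. exp (- (D * t)) * (t ^ j / fact j) * (gen ^^ j) (heat UNIV h s) x) has_sum
      heat UNIV (heat UNIV h s) t x) UNIV" if "tame h" for h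
    using heat_has_sum[OF tame_heat[OF that assms(2)], of t UNIV x] by (simp add: diter_UNIV)
  have dom: "\<bar>a j k\<bar> \<le> a' j k" for j k
    unfolding a_def a'_def using assms geniter_abs_le by (intro abs_mult_le) auto
  define r where "r = heat UNIV (heat UNIV g s) t x"
  have r: "((\<lambda>(j, k). a j k) has_sum r) (UNIV \<times> UNIV)"
    unfolding r_def
    by (rule has_sum_prodI[OF rows total[OF g] dom rows'])
      (use total[OF tame_abs[OF g]] in \<open>auto simp: summable_on_def\<close>)
  \<comment> \<open>Pairs are reindexed by their diagonal \<open>n = j + k\<close> and their first
    entry \<open>j\<close>.\<close>
  have bij: "bij_betw (\<lambda>(n, j). (j, n - j)) (SIGMA n:UNIV. {..n::nat}) (UNIV \<times> UNIV)"
    by (rule bij_betwI[where g = "\<lambda>(j, k). (j + k, j)"]) auto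
  have "((\<lambda>(n, j). a j (n - j)) has_sum r) (SIGMA n:UNIV. {..n})"
    using r has_sum_reindex_bij_betw[OF bij, of "\<lambda>(j, k). a j k" r] by (simp add: case_prod_unfold)
  moreover have "((\<lambda>j. a j (n - j)) has_sum
      exp (- (D * (s + t))) * ((s + t) ^ n / fact n) * diter UNIV g n x) {..n}" for n
  proof (rule has_sum_finiteI)
    have "(\<Sum>j\<le>n. a j (n - j)) = (\<Sum>j\<le>n. exp (- (D * (s + t))) * (t ^ j / fact j * (s ^ (n - j) / fact (n - j))) * diter UNIV g n x)"
    proof (rule sum.cong[OF refl])
      fix j assume "j \<in> {..n}"
      moreover have "exp (- (D * (s + t))) = exp (- (D * t)) * exp (- (D * s))"
        by (simp add: exp_add[symmetric] distrib_left)
      ultimately show "a j (n - j)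
          = exp (- (D * (s + t))) * (t ^ j / fact j * (s ^ (n - j) / fact (n - j))) * diter UNIV g n x"
        by (simp add: a_def diter_UNIV)
    qed
    then show "exp (- (D * (s + t))) * ((s + t) ^ n / fact n) * diter UNIV g n x = (\<Sum>j\<le>n. a j (n - j))"
      by (simp add: exp_power_add[of t s, unfolded add.commute[of t s]] sum_distrib_left sum_distrib_right)
  qed simp
  ultimately have "((\<lambda>n. exp (- (D * (s + t))) * ((s + t) ^ n / fact n) * diter UNIV g n x) has_sum r) UNIV"
    by (rule has_sum_SigmaD[where f = "\<lambda>(n, j). a j (n - j)", unfolded prod.case])
  then have "r = heat UNIV g (s + t) x"
    using heat_has_sum[OF g] has_sum_unique by blast
  then show ?thesis by (simp add: r_def)
qed

end

section \<open>Energy decay of Dirichlet solutions\<close>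

text \<open>With \<open>A\<close> and \<open>B\<close> the roots of \<open>- a\<close> and
  \<open>- b\<close>, the hypothesis says |c| \<le> A B, so the form is at most -(A |p| - B
  |q|)^2.\<close>

lemma quadratic_form_nonpos:
  fixes a b c p q :: real
  assumes "c\<^sup>2 \<le> a * b" "a \<le> 0" "b \<le> 0"
  shows "2 * c * p * q + a * p\<^sup>2 + b * q\<^sup>2 \<le> 0"
proof -
  define A B where "A = sqrt (- a)" and "B = sqrt (- b)"
  have AB: "A\<^sup>2 = - a" "B\<^sup>2 = - b" "0 \<le> A" "0 \<le> B"
    using assms by (simp_all add: A_def B_def)
  have "\<bar>c\<bar>\<^sup>2 \<le> (A * B)\<^sup>2"
    using assms(1) by (simp add: power_mult_distrib AB)
  then have "\<bar>c\<bar> \<le> A * B"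
    by (rule power2_le_imp_le) (simp add: AB)
  then have "\<bar>c\<bar> * (\<bar>p\<bar> * \<bar>q\<bar>) \<le> A * B * (\<bar>p\<bar> * \<bar>q\<bar>)"
    by (rule mult_right_mono) simp
  moreover have "c * p * q \<le> \<bar>c\<bar> * (\<bar>p\<bar> * \<bar>q\<bar>)"
    using abs_ge_self[of "c * p * q"] by (simp add: abs_mult)
  moreover have "(A * \<bar>p\<bar>)\<^sup>2 + (B * \<bar>q\<bar>)\<^sup>2 - 2 * (A * B * (\<bar>p\<bar> * \<bar>q\<bar>)) \<ge> 0"
    using zero_le_power2[of "A * \<bar>p\<bar> - B * \<bar>q\<bar>"] by (simp add: power2_diff mult_ac)
  ultimately show ?thesis
    by (simp add: power_mult_distrib AB)
qed

section \<open>Green's formula and the differential inequality for the energy\<close>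

context weighted_graph
begin

text \<open>Every edge on which a function supported in \<Omega> varies has both ends in this closed
  neighbourhood, so sums over vertices reduce to one fixed finite set.\<close>

definition nbhd :: "'v set \<Rightarrow> 'v set" where
  "nbhd \<Omega> = \<Omega> \<union> (\<Union>x\<in>\<Omega>. E `` {x})"

lemma finite_nbhd: "finite \<Omega> \<Longrightarrow> finite (nbhd \<Omega>)"
  unfolding nbhd_def using locally_finite by auto

lemma subset_nbhd: "\<Omega> \<subseteq> nbhd \<Omega>"
  unfolding nbhd_def by auto

lemma neighbours_subset_nbhd: "x \<in> \<Omega> \<Longrightarrow> E `` {x} \<subseteq> nbhd \<Omega>"
  unfolding nbhd_def by auto

lemma sum_laplacian:
  assumes "finite S" "nbhd \<Omega> \<subseteq> S" "\<And>x. x \<notin> \<Omega> \<Longrightarrow> h x = 0"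
  shows "(\<Sum>x\<in>S. m x * (h x * \<Delta> k x)) = (\<Sum>x\<in>S. \<Sum>y\<in>S. w x y * (h x * (k y - k x)))"
proof (rule sum.cong[OF refl])
  fix x assume "x \<in> S"
  show "m x * (h x * \<Delta> k x) = (\<Sum>y\<in>S. w x y * (h x * (k y - k x)))"
  proof (cases "x \<in> \<Omega>")
    case True
    then have "E `` {x} \<subseteq> S" using neighbours_subset_nbhd assms(2) by blast
    have "m x * (h x * \<Delta> k x) = h x * (\<Sum>y\<in>E `` {x}. w x y * (k y - k x))"
      using measure_pos[of x] by (simp add: laplacian_def)
    also have "\<dots> = h x * (\<Sum>y\<in>S. w x y * (k y - k x))"
      using sum_neighbours[OF assms(1) \<open>E `` {x} \<subseteq> S\<close>] by simp
    finally show ?thesis by (simp add: sum_distrib_left mult.left_commute)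
  qed (use assms(3) in simp)
qed

lemma sum_symmetrize:
  "2 * (\<Sum>x\<in>S. \<Sum>y\<in>S. w x y * F x y) = (\<Sum>x\<in>S. \<Sum>y\<in>S. w x y * (F x y + F y x))"
proof -
  have "(\<Sum>x\<in>S. \<Sum>y\<in>S. w x y * F x y) = (\<Sum>x\<in>S. \<Sum>y\<in>S. w x y * F y x)"
    by (subst sum.swap) (simp add: weight_sym)
  then show ?thesis
    by (simp add: distrib_left sum.distrib)
qed

text \<open>Only \<open>h\<close> needs support in \<Omega>, since rows at other vertices carry the
  factor \<open>h x = 0\<close>. Symmetrizing in \<open>x\<close> and \<open>y\<close> produces the
  product of differences; the factor 2 appears because each edge is met in both directions.\<close>

lemma green_formula:
  assumes "finite S" "nbhd \<Omega> \<subseteq> S" "\<And>x. x \<notin> \<Omega> \<Longrightarrow> h x = 0"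
  shows "2 * (\<Sum>x\<in>S. m x * (h x * \<Delta> k x)) = - (\<Sum>x\<in>S. \<Sum>y\<in>S. w x y * ((h x - h y) * (k x - k y)))"
proof -
  have "2 * (\<Sum>x\<in>S. m x * (h x * \<Delta> k x))
      = (\<Sum>x\<in>S. \<Sum>y\<in>S. w x y * (h x * (k y - k x) + h y * (k x - k y)))"
    using sum_laplacian[OF assms(1,2), of h k, OF assms(3)] sum_symmetrize[of "\<lambda>x y. h x * (k y - k x)" S]
    by simp
  also have "\<dots> = (\<Sum>x\<in>S. \<Sum>y\<in>S. - (w x y * ((h x - h y) * (k x - k y))))"
    by (intro sum.cong refl) (simp add: algebra_simps)
  finally show ?thesis by (simp add: sum_negf)
qed

definition rayleigh_bound :: "real \<Rightarrow> bool" where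
  "rayleigh_bound l \<longleftrightarrow> (\<forall>S g. finite S \<longrightarrow> (\<forall>x. x \<notin> S \<longrightarrow> g x = 0) \<longrightarrow>
     l * (\<Sum>x\<in>S. m x * (g x)\<^sup>2) \<le> - (\<Sum>x\<in>S. m x * (g x * \<Delta> g x)))"

lemma rayleigh_bound_0: "rayleigh_bound 0"
  unfolding rayleigh_bound_def
proof (intro allI impI)
  fix S and g :: "'v \<Rightarrow> real"
  assume S: "finite S" "\<forall>x. x \<notin> S \<longrightarrow> g x = 0"
  have "0 \<le> (\<Sum>x\<in>nbhd S. \<Sum>y\<in>nbhd S. w x y * ((g x - g y) * (g x - g y)))"
    using weight_nonneg by (intro sum_nonneg mult_nonneg_nonneg[OF _ zero_le_square])
  then have "(\<Sum>x\<in>nbhd S. m x * (g x * \<Delta> g x)) \<le> 0"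
    using green_formula[OF finite_nbhd[OF S(1)] order_refl, of g g] S(2) by simp
  also have "(\<Sum>x\<in>nbhd S. m x * (g x * \<Delta> g x)) = (\<Sum>x\<in>S. m x * (g x * \<Delta> g x))"
    by (rule sum.mono_neutral_right) (use S finite_nbhd subset_nbhd in auto)
  finally show "0 * (\<Sum>x\<in>S. m x * (g x)\<^sup>2) \<le> - (\<Sum>x\<in>S. m x * (g x * \<Delta> g x))"
    by simp
qed

lemma weighted_energy_derivative_le:
  assumes \<Omega>: "finite \<Omega>" and v: "\<And>x. x \<notin> \<Omega> \<Longrightarrow> v x = 0"
    and l: "rayleigh_bound l"
    and K: "\<And>x. 0 \<le> K x" and K': "\<And>x. K' x \<le> 0"
    and \<gamma>: "0 \<le> \<gamma>" "\<gamma> \<le> 1"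
    and ineq: "\<And>x y. (x, y) \<in> E \<Longrightarrow> (K x + K y - 2 * (1 - \<gamma>) * sqrt (K x * K y))\<^sup>2
      \<le> (1 / D * K' x - 2 * \<gamma> * K x) * (1 / D * K' y - 2 * \<gamma> * K y)"
  shows "(\<Sum>x\<in>\<Omega>. m x * (K' x * (v x)\<^sup>2 + 2 * K x * v x * \<Delta> v x)) \<le>
    - (2 * (1 - \<gamma>) * l * (\<Sum>x\<in>\<Omega>. m x * (K x * (v x)\<^sup>2)))"
proof -
  define S where "S = nbhd \<Omega>"
  have S: "finite S" "nbhd \<Omega> \<subseteq> S" "\<Omega> \<subseteq> S"
    unfolding S_def using finite_nbhd \<Omega> subset_nbhd by auto
  \<comment> \<open>The test function for the Rayleigh bound: its squared norm is the weighted
    energy of \<open>v\<close>.\<close>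
  define g where "g x = sqrt (K x) * v x" for x
  have g: "\<And>x. x \<notin> \<Omega> \<Longrightarrow> g x = 0" and gg: "(g x)\<^sup>2 = K x * (v x)\<^sup>2" for x
    using v K by (simp_all add: g_def power_mult_distrib)
  have ext: "(\<Sum>x\<in>\<Omega>. f x) = (\<Sum>x\<in>S. f x)" if "\<And>x. v x = 0 \<Longrightarrow> f x = 0" for f :: "'v \<Rightarrow> real"
    by (rule sum.mono_neutral_left) (use S that v in auto)
  \<comment> \<open>As \<open>K' x \<le> 0\<close>, replacing \<open>m x\<close> by the smaller
    \<open>weighted_deg E w x / D\<close> can only increase the term; the degree is then distributed
    over the edges.\<close>
  have T1: "2 * (\<Sum>x\<in>\<Omega>. m x * (K' x * (v x)\<^sup>2))
      \<le> (\<Sum>x\<in>S. \<Sum>y\<in>S. w x y * (1 / D * K' x * (v x)\<^sup>2 + 1 / D * K' y * (v y)\<^sup>2))"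
  proof -
    have "(\<Sum>x\<in>\<Omega>. m x * (K' x * (v x)\<^sup>2)) \<le> (\<Sum>x\<in>\<Omega>. \<Sum>y\<in>S. w x y * (1 / D * K' x * (v x)\<^sup>2))"
    proof (rule sum_mono)
      fix x assume "x \<in> \<Omega>"
      have "weighted_deg E w x = (\<Sum>y\<in>S. w x y)"
        unfolding weighted_deg_def
        using sum_neighbours[OF S(1) order_trans[OF neighbours_subset_nbhd[OF \<open>x \<in> \<Omega>\<close>] S(2)], of "\<lambda>_. 1"]
        by simp
      \<comment> \<open>For \<open>D = 0\<close> the quotient is 0 by convention, and the bound is
        positivity of \<open>m\<close>.\<close>
      moreover have "weighted_deg E w x / D \<le> m x"
        using weighted_deg_le[of x] D_nonneg measure_pos[of x]
        by (cases "D = 0") (auto simp: field_simps)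
      ultimately have "m x * (K' x * (v x)\<^sup>2) \<le> (\<Sum>y\<in>S. w x y) / D * (K' x * (v x)\<^sup>2)"
        using K' by (intro mult_right_mono_neg) (auto simp: mult_nonpos_nonneg)
      then show "m x * (K' x * (v x)\<^sup>2) \<le> (\<Sum>y\<in>S. w x y * (1 / D * K' x * (v x)\<^sup>2))"
        by (simp add: sum_distrib_right sum_divide_distrib)
    qed
    also have "\<dots> = (\<Sum>x\<in>S. \<Sum>y\<in>S. w x y * (1 / D * K' x * (v x)\<^sup>2))"
      by (rule ext) simp
    finally show ?thesis
      unfolding sum_symmetrize[symmetric] by simp
  qed
  have T2: "2 * (\<Sum>x\<in>\<Omega>. m x * (K x * v x * \<Delta> v x))
      = (\<Sum>x\<in>S. \<Sum>y\<in>S. w x y * (K x * v x * (v y - v x) + K y * v y * (v x - v y)))"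
    unfolding sum_symmetrize[symmetric]
    by (subst ext) (use sum_laplacian[OF S(1,2), of "\<lambda>x. K x * v x" v] v in simp_all)
  have T3: "2 * (l * (\<Sum>x\<in>\<Omega>. m x * (K x * (v x)\<^sup>2)))
      \<le> (\<Sum>x\<in>S. \<Sum>y\<in>S. w x y * ((g x - g y) * (g x - g y)))"
  proof -
    have "l * (\<Sum>x\<in>\<Omega>. m x * (K x * (v x)\<^sup>2)) \<le> - (\<Sum>x\<in>\<Omega>. m x * (g x * \<Delta> g x))"
      using l[unfolded rayleigh_bound_def, rule_format, OF \<Omega> g] by (simp add: gg)
    also have "\<dots> = - (\<Sum>x\<in>S. m x * (g x * \<Delta> g x))"
      by (subst ext) (simp_all add: g_def)
    finally show ?thesis
      using green_formula[OF S(1,2), of g g] g by simp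
  qed
  \<comment> \<open>In the summand of an edge, \<open>?a x\<close> is the coefficient of the square
    of \<open>v x\<close> and \<open>?c x y\<close> is half that of \<open>v x * v y\<close>. The
    Laplacian contributes -2 \<open>K x\<close> to the former and the Rayleigh term 2(1 - \<gamma>)
    \<open>K x\<close>, which leaves -2 \<gamma> \<open>K x\<close>.\<close>
  let ?a = "\<lambda>x. 1 / D * K' x - 2 * \<gamma> * K x"
  let ?c = "\<lambda>x y. K x + K y - 2 * (1 - \<gamma>) * sqrt (K x * K y)"
  have a: "?a x \<le> 0" for x
  proof -
    have "1 / D * K' x \<le> 0" using K' D_nonneg by (intro mult_nonneg_nonpos) auto
    moreover have "0 \<le> 2 * \<gamma> * K x" using K \<gamma> by simp
    ultimately show ?thesis by linarith
  qed
  have "2 * (\<Sum>x\<in>\<Omega>. m x * (K' x * (v x)\<^sup>2)) + 2 * (2 * (\<Sum>x\<in>\<Omega>. m x * (K x * v x * \<Delta> v x)))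
      + 2 * (1 - \<gamma>) * (2 * (l * (\<Sum>x\<in>\<Omega>. m x * (K x * (v x)\<^sup>2))))
    \<le> (\<Sum>x\<in>S. \<Sum>y\<in>S. w x y * (1 / D * K' x * (v x)\<^sup>2 + 1 / D * K' y * (v y)\<^sup>2))
      + 2 * (\<Sum>x\<in>S. \<Sum>y\<in>S. w x y * (K x * v x * (v y - v x) + K y * v y * (v x - v y)))
      + 2 * (1 - \<gamma>) * (\<Sum>x\<in>S. \<Sum>y\<in>S. w x y * ((g x - g y) * (g x - g y)))"
  proof (intro add_mono T1 mult_left_mono[OF T3])
    show "2 * (2 * (\<Sum>x\<in>\<Omega>. m x * (K x * v x * \<Delta> v x)))
        \<le> 2 * (\<Sum>x\<in>S. \<Sum>y\<in>S. w x y * (K x * v x * (v y - v x) + K y * v y * (v x - v y)))"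
      unfolding T2 by (rule order_refl)
  qed (use \<gamma>(2) in simp)
  also have "\<dots> = (\<Sum>x\<in>S. \<Sum>y\<in>S. w x y * (2 * ?c x y * v x * v y + ?a x * (v x)\<^sup>2 + ?a y * (v y)\<^sup>2))"
  proof -
    have "w x y * (1 / D * K' x * (v x)\<^sup>2 + 1 / D * K' y * (v y)\<^sup>2)
        + 2 * (w x y * (K x * v x * (v y - v x) + K y * v y * (v x - v y)))
        + 2 * (1 - \<gamma>) * (w x y * ((g x - g y) * (g x - g y)))
      = w x y * (2 * ?c x y * v x * v y + ?a x * (v x)\<^sup>2 + ?a y * (v y)\<^sup>2)" for x y
    proof -
      have "(g x - g y) * (g x - g y) = K x * (v x)\<^sup>2 + K y * (v y)\<^sup>2 - 2 * (sqrt (K x * K y) * v x * v y)"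
      proof -
        have "g x * g y = sqrt (K x * K y) * v x * v y"
          by (simp add: g_def real_sqrt_mult)
        then show ?thesis
          unfolding gg[symmetric] by (simp add: power2_eq_square algebra_simps)
      qed
      then show ?thesis
        by (simp only:) (simp add: power2_eq_square algebra_simps)
    qed
    then show ?thesis
      by (simp only: sum_distrib_left sum.distrib[symmetric])
  qed
  also have "\<dots> \<le> 0"
  proof (intro sum_nonpos)
    fix x y
    show "w x y * (2 * ?c x y * v x * v y + ?a x * (v x)\<^sup>2 + ?a y * (v y)\<^sup>2) \<le> 0"
    proof (cases "(x, y) \<in> E")
      case True
      then show ?thesis
        using quadratic_form_nonpos[OF ineq a a] weight_nonneg by (intro mult_nonneg_nonpos) auto
    qed (simp add: weight_eq_0)
  qed
  \<comment> \<open>The common factor 2 from the symmetrization is divided out.\<close>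
  finally have "(\<Sum>x\<in>\<Omega>. m x * (K' x * (v x)\<^sup>2)) + 2 * (\<Sum>x\<in>\<Omega>. m x * (K x * v x * \<Delta> v x))
      + 2 * (1 - \<gamma>) * l * (\<Sum>x\<in>\<Omega>. m x * (K x * (v x)\<^sup>2)) \<le> 0"
    by simp
  moreover have "(\<Sum>x\<in>\<Omega>. m x * (K' x * (v x)\<^sup>2 + 2 * K x * v x * \<Delta> v x))
      = (\<Sum>x\<in>\<Omega>. m x * (K' x * (v x)\<^sup>2)) + 2 * (\<Sum>x\<in>\<Omega>. m x * (K x * v x * \<Delta> v x))"
    by (simp add: sum_distrib_left sum.distrib[symmetric] distrib_left mult_ac)
  ultimately show ?thesis by linarith
qed

text \<open>Gronwall's argument: the preceding estimate reads J' \<le> -c J, so multiplying by the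
  integrating factor exp(c t) gives a nonpositive derivative.\<close>

lemma weighted_energy_decreasing:
  assumes \<Omega>: "finite \<Omega>"
    and v: "\<And>t x. 0 \<le> t \<Longrightarrow> x \<notin> \<Omega> \<Longrightarrow> v t x = 0"
    and v_deriv: "\<And>t x. 0 \<le> t \<Longrightarrow> x \<in> \<Omega> \<Longrightarrow>
      ((\<lambda>s. v s x) has_real_derivative \<Delta> (v t) x) (at t within {0..})"
    and l: "rayleigh_bound l"
    and K: "\<And>t x. 0 \<le> t \<Longrightarrow> 0 \<le> K t x" and K': "\<And>t x. 0 \<le> t \<Longrightarrow> K' t x \<le> 0"
    and K_deriv: "\<And>t x. 0 \<le> t \<Longrightarrow> ((\<lambda>s. K s x) has_real_derivative K' t x) (at t within {0..})"
    and \<gamma>: "0 \<le> \<gamma>" "\<gamma> \<le> 1"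
    and ineq: "\<And>t x y. 0 \<le> t \<Longrightarrow> (x, y) \<in> E \<Longrightarrow>
      (K t x + K t y - 2 * (1 - \<gamma>) * sqrt (K t x * K t y))\<^sup>2
      \<le> (1 / D * K' t x - 2 * \<gamma> * K t x) * (1 / D * K' t y - 2 * \<gamma> * K t y)"
    and t: "0 \<le> t"
  shows "exp (2 * (1 - \<gamma>) * l * t) * (\<Sum>x\<in>\<Omega>. m x * (K t x * (v t x)\<^sup>2))
    \<le> (\<Sum>x\<in>\<Omega>. m x * (K 0 x * (v 0 x)\<^sup>2))"
proof -
  define c where "c = 2 * (1 - \<gamma>) * l"
  define J where "J t = (\<Sum>x\<in>\<Omega>. m x * (K t x * (v t x)\<^sup>2))" for t
  define J' where "J' t = (\<Sum>x\<in>\<Omega>. m x * (K' t x * (v t x)\<^sup>2 + 2 * K t x * v t x * \<Delta> (v t) x))" for t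
  have J_deriv: "(J has_real_derivative J' t) (at t within {0..})" if "0 \<le> t" for t
    unfolding J_def J'_def
  proof (rule DERIV_sum)
    fix x assume "x \<in> \<Omega>"
    show "((\<lambda>t. m x * (K t x * (v t x)\<^sup>2)) has_real_derivative
        m x * (K' t x * (v t x)\<^sup>2 + 2 * K t x * v t x * \<Delta> (v t) x)) (at t within {0..})"
      by (rule derivative_eq_intros K_deriv[OF that] v_deriv[OF that \<open>x \<in> \<Omega>\<close>] refl)+ simp
  qed
  have deriv: "((\<lambda>t. exp (c * t) * J t) has_real_derivative exp (c * t) * (J' t + c * J t))
      (at t within {0..})" if "0 \<le> t" for t
    by (rule derivative_eq_intros J_deriv[OF that] refl)+ (simp add: algebra_simps)
  have nonpos: "exp (c * t) * (J' t + c * J t) \<le> 0" if "0 \<le> t" for t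
  proof -
    have "J' t \<le> - (c * J t)"
      unfolding J_def J'_def c_def
      using that by (intro weighted_energy_derivative_le \<Omega> v l K K' \<gamma> ineq)
    then show ?thesis by (simp add: mult_nonneg_nonpos)
  qed
  have "exp (c * t) * J t \<le> exp (c * 0) * J 0"
  \<comment> \<open>Derivatives are required only in the open interval, where the one-sided ones are
    two-sided; at the endpoints continuity suffices.\<close>
  proof (rule DERIV_nonpos_imp_decreasing_open[OF t])
    fix x assume "0 < x" "x < t"
    have "at x within {0..} = at x"
      by (rule at_within_interior) (use \<open>0 < x\<close> in simp)
    then have "((\<lambda>t. exp (c * t) * J t) has_real_derivative exp (c * x) * (J' x + c * J x)) (at x)"
      using deriv[of x] \<open>0 < x\<close> by simp
    moreover have "exp (c * x) * (J' x + c * J x) \<le> 0"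
      using nonpos \<open>0 < x\<close> by simp
    ultimately show "\<exists>y. ((\<lambda>t. exp (c * t) * J t) has_real_derivative y) (at x) \<and> y \<le> 0"
      by blast
  next
    have "continuous_on {0..} (\<lambda>t. exp (c * t) * J t)"
      by (rule DERIV_continuous_on, rule deriv) simp
    then show "continuous_on {0..t} (\<lambda>t. exp (c * t) * J t)"
      by (rule continuous_on_subset) auto
  qed
  then show ?thesis by (simp add: J_def c_def)
qed

end

section \<open>Identification of the heat kernel\<close>

context weighted_graph
begin

lemma dirichlet_heat_solution_unique:
  assumes "finite \<Omega>" "0 \<le> t"
    and "dirichlet_heat_solution E w m \<Omega> y u" "dirichlet_heat_solution E w m \<Omega> y v"
  shows "u t x = v t x"
proof (cases "x \<in> \<Omega>")
  case True
  define d where "d s z = u s z - v s z" for s z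
  \<comment> \<open>Energy decay with \<open>K = 1\<close>, \<open>K' = 0\<close>, \<gamma> = 1 and
    rate 0: the edge condition becomes 4 \<le> 4, and the energy of the difference starts at
    0.\<close>
  have "exp (2 * (1 - 1) * 0 * t) * (\<Sum>z\<in>\<Omega>. m z * (1 * (d t z)\<^sup>2)) \<le> (\<Sum>z\<in>\<Omega>. m z * (1 * (d 0 z)\<^sup>2))"
  proof (rule weighted_energy_decreasing[OF assms(1) _ _ rayleigh_bound_0, where K' = "\<lambda>_ _. 0"])
    fix s z assume "0 \<le> (s::real)" "z \<in> \<Omega>"
    then have "((\<lambda>s. d s z) has_real_derivative \<Delta> (u s) z - \<Delta> (v s) z) (at s within {0..})"
      unfolding d_def using assms(3,4) by (intro DERIV_diff) (auto simp: dirichlet_heat_solution_def)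
    moreover have "\<Delta> (u s) z - \<Delta> (v s) z = \<Delta> (d s) z"
      using laplacian_diff[of "u s" 1 "v s" z] by (simp add: d_def[abs_def])
    ultimately show "((\<lambda>s. d s z) has_real_derivative \<Delta> (d s) z) (at s within {0..})"
      by simp
  qed (use assms in \<open>auto simp: d_def dirichlet_heat_solution_def\<close>)
  also have "(\<Sum>z\<in>\<Omega>. m z * (1 * (d 0 z)\<^sup>2)) = 0"
    using assms(3,4) by (intro sum.neutral) (simp add: d_def dirichlet_heat_solution_def)
  finally have "(\<Sum>z\<in>\<Omega>. m z * (d t z)\<^sup>2) \<le> 0" by simp
  moreover have "m x * (d t x)\<^sup>2 \<le> (\<Sum>z\<in>\<Omega>. m z * (d t z)\<^sup>2)"
    using assms(1) True less_imp_le[OF measure_pos] by (intro member_le_sum) auto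
  ultimately have "m x * (d t x)\<^sup>2 \<le> 0"
    by (rule order_trans[rotated])
  then have "d t x = 0"
    using measure_pos[of x] by (simp add: mult_le_0_iff)
  then show ?thesis by (simp add: d_def)
next
  case False
  then show ?thesis using assms by (simp add: dirichlet_heat_solution_def)
qed

definition dirac :: "'v \<Rightarrow> 'v \<Rightarrow> real" where
  "dirac y z = (if z = y then 1 / m y else 0)"

lemma tame_dirac: "tame (dirac y)"
  by (rule tame_finite_support[of "{y}"]) (auto simp: dirac_def)

text \<open>The series solves the Dirichlet problem and energy decay gives uniqueness, so the
  definite description denotes it.\<close>

lemma dirichlet_heat_kernel_eq:
  assumes "finite \<Omega>" "0 \<le> t"
  shows "dirichlet_heat_kernel E w m \<Omega> t x y = heat \<Omega> (dirac y) t x"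
proof -
  have sol: "dirichlet_heat_solution E w m \<Omega> y (heat \<Omega> (dirac y))"
    unfolding dirichlet_heat_solution_def
    using heat_deriv[OF tame_dirac] heat_outside heat_0
    by (auto simp: dirac_def intro: has_field_derivative_at_within)
  show ?thesis
    unfolding dirichlet_heat_kernel_def
  proof (rule the_equality)
    show "\<exists>u. dirichlet_heat_solution E w m \<Omega> y u \<and> heat \<Omega> (dirac y) t x = u t x"
      using sol by (intro exI[of _ "heat \<Omega> (dirac y)"] conjI refl)
    fix r assume "\<exists>u. dirichlet_heat_solution E w m \<Omega> y u \<and> r = u t x"
    then obtain u where "dirichlet_heat_solution E w m \<Omega> y u" "r = u t x" by (elim exE conjE)
    then show "r = heat \<Omega> (dirac y) t x"
      using dirichlet_heat_solution_unique[OF assms _ sol] by simp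
  qed
qed

text \<open>Balls about a vertex are finite by local finiteness and cover everything by
  connectedness. One exhaustion must exist, or the condition defining \<open>heat_kernel\<close>
  would be vacuous.\<close>

lemma exhaustion_exists: "\<exists>\<Omega>. exhaustion (\<Omega> :: nat \<Rightarrow> 'v set)"
proof -
  fix x\<^sub>0 :: 'v
  define \<Omega> where "\<Omega> n = (nbhd ^^ n) {x\<^sub>0}" for n
  have "finite (\<Omega> n)" for n
    unfolding \<Omega>_def by (induction n) (auto intro: finite_nbhd)
  moreover have "incseq \<Omega>"
    unfolding \<Omega>_def incseq_Suc_iff using subset_nbhd by simp
  moreover have "\<exists>n. x \<in> \<Omega> n" for x
    using connected[of x\<^sub>0 x]
  proof induction
    case base
    show ?case by (intro exI[of _ 0]) (simp add: \<Omega>_def)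
  next
    case (step y z)
    then obtain n where "y \<in> \<Omega> n" by blast
    then have "z \<in> \<Omega> (Suc n)"
      using step(2) neighbours_subset_nbhd[of y "\<Omega> n"] by (auto simp: \<Omega>_def)
    then show ?case by blast
  qed
  ultimately show ?thesis
    unfolding exhaustion_def by (intro exI[of _ \<Omega>]) auto
qed

lemma heat_kernel_eq:
  assumes "0 \<le> t"
  shows "heat_kernel E w m t x y = heat UNIV (dirac y) t x"
proof -
  have lim: "(\<lambda>i. dirichlet_heat_kernel E w m (\<Omega> i) t x y) \<longlonglongrightarrow> heat UNIV (dirac y) t x"
    if "exhaustion \<Omega>" for \<Omega>
    using that heat_exhaustion[OF that tame_dirac] assms
    by (simp add: exhaustion_def dirichlet_heat_kernel_eq)
  obtain \<Omega> :: "nat \<Rightarrow> 'v set" where \<Omega>: "exhaustion \<Omega>" using exhaustion_exists ..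
  show ?thesis
    unfolding heat_kernel_def
  proof (rule the_equality)
    fix r assume "\<forall>\<Omega>. exhaustion \<Omega> \<longrightarrow> (\<lambda>i. dirichlet_heat_kernel E w m (\<Omega> i) t x y) \<longlonglongrightarrow> r"
    then have "(\<lambda>i. dirichlet_heat_kernel E w m (\<Omega> i) t x y) \<longlonglongrightarrow> r"
      using \<Omega> by simp
    then show "r = heat UNIV (dirac y) t x"
      using lim[OF \<Omega>] by (rule LIMSEQ_unique)
  qed (intro allI impI lim)
qed

text \<open>\<open>f\<close> is pointwise the sum of the Dirac functions weighted by
  \<open>f y * m y\<close>, and the iterate, a finite combination of values at each vertex, passes
  through that sum.\<close>

lemma geniter_dirac_has_sum:
  "((\<lambda>y. (gen ^^ k) (dirac y) x * f y * m y) has_sum (gen ^^ k) f x) UNIV"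
proof -
  have "((\<lambda>y. f y * m y * dirac y z) has_sum f z) UNIV" for z
    by (rule has_sum_finite_neutralI[of "{z}"]) (use measure_pos[of z] in \<open>auto simp: dirac_def\<close>)
  then have "((\<lambda>y. (gen ^^ k) (\<lambda>z. f y * m y * dirac y z) x) has_sum (gen ^^ k) f x) UNIV"
    by (rule geniter_has_sum)
  then show ?thesis by (simp add: geniter_cmult mult_ac)
qed

text \<open>The sum over iterates is exchanged with the sum over vertices; since iterated Dirac
  functions are nonnegative, the same expansion for the absolute value of \<open>f\<close> is the
  majorant.\<close>

lemma heat_semigroup_eq:
  assumes "tame f" "0 \<le> t"
  shows "heat_semigroup E w m f t x = heat UNIV f t x"
proof -
  define c where "c k = exp (- (D * t)) * (t ^ k / fact k)" for k
  have c: "0 \<le> c k" for k using assms(2) by (simp add: c_def)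
  define a where "a k y = c k * ((gen ^^ k) (dirac y) x * f y * m y)" for k y
  have rows: "(a k has_sum c k * (gen ^^ k) f x) UNIV" for k
    unfolding a_def by (intro has_sum_cmult_right geniter_dirac_has_sum)
  have rows': "((\<lambda>y. c k * ((gen ^^ k) (dirac y) x * \<bar>f y\<bar> * m y)) has_sum
      c k * (gen ^^ k) (\<lambda>z. \<bar>f z\<bar>) x) UNIV" for k
    by (intro has_sum_cmult_right geniter_dirac_has_sum)
  have total: "((\<lambda>k. c k * (gen ^^ k) h x) has_sum heat UNIV h t x) UNIV" if "tame h" for h
    using heat_has_sum[OF that, of t UNIV x] by (simp only: c_def diter_UNIV)
  have dirac_nonneg: "0 \<le> (gen ^^ k) (dirac y) x" for k y
    using measure_pos[of y] by (intro geniter_nonneg) (simp add: dirac_def)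
  have "((\<lambda>(k, y). a k y) has_sum heat UNIV f t x) (UNIV \<times> UNIV)"
  proof (rule has_sum_prodI[OF rows total[OF assms(1)] _ rows'])
    show "\<bar>a k y\<bar> \<le> c k * ((gen ^^ k) (dirac y) x * \<bar>f y\<bar> * m y)" for k y
      unfolding a_def using dirac_nonneg[of k y] measure_pos[of y]
      by (intro abs_mult_le c) (simp add: abs_mult)
    show "(\<lambda>k. c k * (gen ^^ k) (\<lambda>z. \<bar>f z\<bar>) x) summable_on UNIV"
      using total[OF tame_abs[OF assms(1)]] unfolding summable_on_def by blast
  qed
  moreover have "((\<lambda>k. a k y) has_sum heat_kernel E w m t x y * f y * m y) UNIV" for y
  proof -
    have "((\<lambda>k. c k * (gen ^^ k) (dirac y) x * (f y * m y)) has_sum heat UNIV (dirac y) t x * (f y * m y)) UNIV"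
      by (intro has_sum_cmult_left total tame_dirac)
    then show ?thesis
      by (simp only: a_def heat_kernel_eq[OF assms(2)] mult.assoc)
  qed
  ultimately have "((\<lambda>y. heat_kernel E w m t x y * f y * m y) has_sum heat UNIV f t x) UNIV"
    by (rule has_sum_swap_cols)
  then show ?thesis
    unfolding heat_semigroup_def by (rule infsumI)
qed

end

section \<open>The resolvent at negative reals\<close>

text \<open>Applied to T((g - a)^2) \<ge> 0 for a positive linear T, this yields the Cauchy-Schwarz
  inequality (T g)^2 \<le> T(1) T(g^2).\<close>

lemma discriminant_le:
  fixes p q n :: real
  assumes "\<And>a. 0 \<le> p - 2 * a * q + a\<^sup>2 * n" "0 \<le> n"
  shows "q\<^sup>2 \<le> n * p"
proof (cases "n = 0")
  case True
  have "q = 0"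
  proof (rule ccontr)
    assume "q \<noteq> 0"
    \<comment> \<open>For \<open>n = 0\<close> this choice of \<open>a\<close> gives the polynomial
      the value -1.\<close>
    then show False
      using assms(1)[of "(p + 1) / (2 * q)"] True by simp
  qed
  then show ?thesis using True by simp
next
  case False
  \<comment> \<open>The minimizer \<open>a = q / n\<close> is inserted.\<close>
  then have "0 \<le> n * (p - 2 * (q / n) * q + (q / n)\<^sup>2 * n)"
    using assms by (intro mult_nonneg_nonneg)
  also have "\<dots> = n * p - q\<^sup>2"
    using False by (simp add: field_simps power2_eq_square)
  finally show ?thesis by simp
qed

context weighted_graph
begin

section \<open>The space l^2(V, m) and boundedness of \<open>gen\<close> on it\<close>

lemma l2_iff: "f \<in> lp_space m 2 \<longleftrightarrow> (\<lambda>x. (f x)\<^sup>2 * m x) summable_on UNIV"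
proof -
  have "(2::ereal) \<noteq> \<infinity>" "real_of_ereal 2 = 2"
    by (metis numeral_eq_ereal PInfty_neq_ereal(1), metis numeral_eq_ereal real_of_ereal.simps(1))
  then show ?thesis
    by (simp add: lp_space_def powr_numeral)
qed

lemma l2_norm_square: "(l2_norm m f)\<^sup>2 = (\<Sum>\<^sub>\<infinity>x. (f x)\<^sup>2 * m x)"
  unfolding l2_norm_def using measure_pos[THEN less_imp_le]
  by (intro real_sqrt_pow2 infsum_nonneg) simp

lemma l2_norm_nonneg: "0 \<le> l2_norm m f"
  unfolding l2_norm_def using measure_pos[THEN less_imp_le]
  by (intro real_sqrt_ge_zero infsum_nonneg) simp

lemma sum_le_l2_norm:
  assumes "f \<in> lp_space m 2" "finite F"
  shows "(\<Sum>x\<in>F. m x * (f x)\<^sup>2) \<le> (l2_norm m f)\<^sup>2"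
  using finite_sum_le_infsum[of "\<lambda>x. (f x)\<^sup>2 * m x" UNIV F, OF assms(1)[unfolded l2_iff]]
    assms(2) measure_pos[THEN less_imp_le]
  by (simp add: l2_norm_square mult.commute)

lemma l2I:
  assumes "\<And>F. finite F \<Longrightarrow> (\<Sum>x\<in>F. m x * (f x)\<^sup>2) \<le> A"
  shows "f \<in> lp_space m 2" "(l2_norm m f)\<^sup>2 \<le> A"
proof -
  have b: "(\<Sum>x\<in>F. (f x)\<^sup>2 * m x) \<le> A" if "finite F" for F
    using assms[OF that] by (simp add: mult.commute)
  have *: "(\<lambda>x. (f x)\<^sup>2 * m x) summable_on UNIV"
    using b measure_pos[THEN less_imp_le]
    by (intro nonneg_bdd_above_summable_on) (auto intro!: bdd_aboveI2)
  then show "f \<in> lp_space m 2" unfolding l2_iff .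
  show "(l2_norm m f)\<^sup>2 \<le> A"
    unfolding l2_norm_square by (rule infsum_le_finite_sums[OF *]) (use b in auto)
qed

lemma l2_finite_support:
  assumes "finite S" "\<And>x. x \<notin> S \<Longrightarrow> f x = 0"
  shows "f \<in> lp_space m 2" "(l2_norm m f)\<^sup>2 = (\<Sum>x\<in>S. m x * (f x)\<^sup>2)"
proof -
  have "((\<lambda>x. (f x)\<^sup>2 * m x) has_sum (\<Sum>x\<in>S. m x * (f x)\<^sup>2)) UNIV"
    by (rule has_sum_finite_neutralI[OF assms(1)]) (use assms(2) in \<open>auto simp: mult.commute\<close>)
  then show "f \<in> lp_space m 2" "(l2_norm m f)\<^sup>2 = (\<Sum>x\<in>S. m x * (f x)\<^sup>2)"
    unfolding l2_iff l2_norm_square by (auto simp: summable_on_def dest: infsumI)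
qed

lemma tame_l2:
  assumes "f \<in> lp_space m 2"
  shows "tame f" "tame (\<lambda>x. (f x)\<^sup>2)"
proof -
  have "(1::ereal) \<le> 2" by simp
  then show "tame f" by (rule tame_lp_space[OF assms])
  show "tame (\<lambda>x. (f x)\<^sup>2)"
    using assms[unfolded l2_iff] by (intro tame_summable) auto
qed

lemma geniter_square_expand:
  "(gen ^^ k) (\<lambda>x. (g x - a)\<^sup>2) x = (gen ^^ k) (\<lambda>x. (g x)\<^sup>2) x - 2 * a * (gen ^^ k) g x + a\<^sup>2 * D ^ k"
proof -
  have "(\<lambda>x. (g x - a)\<^sup>2) = (\<lambda>x. (g x)\<^sup>2 + (- 2 * a * g x + a\<^sup>2))"
    by (rule ext) (simp add: power2_eq_square algebra_simps)
  then show ?thesis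
    by (simp only: geniter_add geniter_cmult geniter_const) simp
qed

lemma gen_square_le: "(gen g x)\<^sup>2 \<le> D * gen (\<lambda>x. (g x)\<^sup>2) x"
proof (rule discriminant_le[OF _ D_nonneg])
  fix a
  show "0 \<le> gen (\<lambda>x. (g x)\<^sup>2) x - 2 * a * gen g x + a\<^sup>2 * D"
    using geniter_square_expand[of 1 g a x] geniter_nonneg[of "\<lambda>x. (g x - a)\<^sup>2" 1 x] by simp
qed

text \<open>Cauchy-Schwarz reduces the claim to the mass of \<open>gen\<close> applied to the square
  of \<open>g\<close>, where the l^1 bound applies.\<close>

lemma gen_l2:
  assumes "g \<in> lp_space m 2"
  shows "gen g \<in> lp_space m 2"
proof (rule l2I)
  fix F :: "'v set" assume F: "finite F"
  have "(\<Sum>x\<in>F. m x * (gen g x)\<^sup>2) \<le> (\<Sum>x\<in>F. m x * (D * gen (\<lambda>x. (g x)\<^sup>2) x))"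
    using measure_pos[THEN less_imp_le] gen_square_le by (intro sum_mono mult_left_mono)
  also have "\<dots> = D * (\<Sum>x\<in>F. m x * gen (\<lambda>x. (g x)\<^sup>2) x)"
    by (simp add: sum_distrib_left mult.left_commute)
  also have "\<dots> \<le> D * (D * (l2_norm m g)\<^sup>2)"
    using sum_le_l2_norm[OF assms] D_nonneg F by (intro mult_left_mono sum_gen_le) auto
  finally show "(\<Sum>x\<in>F. m x * (gen g x)\<^sup>2) \<le> D * (D * (l2_norm m g)\<^sup>2)" .
qed

lemma l2_combine:
  assumes "f \<in> lp_space m 2" "g \<in> lp_space m 2"
  shows "(\<lambda>x. a * f x - g x) \<in> lp_space m 2"
proof (rule l2I)
  fix F :: "'v set" assume F: "finite F"
  have "(\<Sum>x\<in>F. m x * (a * f x - g x)\<^sup>2) \<le> (\<Sum>x\<in>F. m x * (2 * a\<^sup>2 * (f x)\<^sup>2 + 2 * (g x)\<^sup>2))"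
  proof (intro sum_mono mult_left_mono)
    fix x
    have "0 \<le> (a * f x + g x)\<^sup>2" by simp
    then show "(a * f x - g x)\<^sup>2 \<le> 2 * a\<^sup>2 * (f x)\<^sup>2 + 2 * (g x)\<^sup>2"
      by (simp add: power2_eq_square algebra_simps)
  qed (use measure_pos[THEN less_imp_le] in auto)
  also have "\<dots> = 2 * a\<^sup>2 * (\<Sum>x\<in>F. m x * (f x)\<^sup>2) + 2 * (\<Sum>x\<in>F. m x * (g x)\<^sup>2)"
    by (simp add: sum_distrib_left sum.distrib distrib_left mult_ac)
  also have "\<dots> \<le> 2 * a\<^sup>2 * (l2_norm m f)\<^sup>2 + 2 * (l2_norm m g)\<^sup>2"
    using assms F by (intro add_mono mult_left_mono sum_le_l2_norm) auto
  finally show "(\<Sum>x\<in>F. m x * (a * f x - g x)\<^sup>2) \<le> 2 * a\<^sup>2 * (l2_norm m f)\<^sup>2 + 2 * (l2_norm m g)\<^sup>2" .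
qed

text \<open>The Neumann series of the inverse of \<open>c - gen\<close>, for \<open>c > D\<close>.
  For \<open>l < 0\<close> and \<open>c = D - l\<close> it inverts -\<Delta> - l.\<close>

definition neumann :: "real \<Rightarrow> ('v \<Rightarrow> real) \<Rightarrow> 'v \<Rightarrow> real" where
  "neumann c g x = (\<Sum>k. (gen ^^ k) g x / c ^ Suc k)"

lemma neumann_sums:
  assumes "tame g" "D < c"
  shows "(\<lambda>k. (gen ^^ k) g x / c ^ Suc k) sums neumann c g x"
  unfolding neumann_def
proof (rule summable_sums)
  have c: "0 < c" using assms(2) D_nonneg by linarith
  obtain B where B: "0 \<le> B" "\<And>k. (gen ^^ k) (\<lambda>z. \<bar>g z\<bar>) x \<le> B * D ^ k"
    by (rule tameE[OF assms(1), where x = x]) (rule that)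
  show "summable (\<lambda>k. (gen ^^ k) g x / c ^ Suc k)"
  proof (rule summable_comparison_test')
    show "summable (\<lambda>k. B / c * (D / c) ^ k)"
      using c D_nonneg assms(2) by (intro summable_mult summable_geometric) simp
    fix k
    have "\<bar>(gen ^^ k) g x\<bar> \<le> B * D ^ k"
      using geniter_abs_le B(2) by (rule order_trans)
    then have "\<bar>(gen ^^ k) g x\<bar> / c ^ Suc k \<le> B * D ^ k / c ^ Suc k"
      using c by (intro divide_right_mono) auto
    then show "norm ((gen ^^ k) g x / c ^ Suc k) \<le> B / c * (D / c) ^ k"
      using c by (simp add: power_divide)
  qed
qed

lemma neumann_const_sums:
  assumes "D < c"
  shows "(\<lambda>k. D ^ k / c ^ Suc k) sums (1 / (c - D))"
proof -
  have c: "0 < c" using assms D_nonneg by linarith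
  have "(\<lambda>k. 1 / c * (D / c) ^ k) sums (1 / c * (1 / (1 - D / c)))"
    using c D_nonneg assms by (intro sums_mult geometric_sums) simp
  then show ?thesis
    using c by (simp add: power_divide field_simps)
qed

lemma gen_neumann:
  assumes "tame g" "D < c"
  shows "gen (neumann c g) x = c * neumann c g x - g x"
proof -
  have c: "0 < c" using assms(2) D_nonneg by linarith
  have "(\<lambda>k. gen (\<lambda>z. inverse (c ^ Suc k) * (gen ^^ k) g z) x) sums gen (neumann c g) x"
    by (rule gen_sums) (use neumann_sums[OF assms] in \<open>simp add: divide_inverse mult.commute\<close>)
  then have "(\<lambda>k. (gen ^^ Suc k) g x / c ^ Suc k) sums gen (neumann c g) x"
    by (simp add: gen_cmult divide_inverse mult.commute)
  \<comment> \<open>The term at k = 0, absent from the shifted series, is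
    \<open>g x\<close>.\<close>
  then have "(\<lambda>k. (gen ^^ k) g x / c ^ k) sums (gen (neumann c g) x + g x)"
    using sums_Suc[of "\<lambda>k. (gen ^^ k) g x / c ^ k"] by simp
  moreover have "(\<lambda>k. c * ((gen ^^ k) g x / c ^ Suc k)) sums (c * neumann c g x)"
    by (rule sums_mult) (rule neumann_sums[OF assms])
  then have "(\<lambda>k. (gen ^^ k) g x / c ^ k) sums (c * neumann c g x)"
    using c by simp
  ultimately show ?thesis
    using sums_unique2 by fastforce
qed

text \<open>The series telescopes, with a remainder of order (D/c)^k.\<close>

lemma neumann_gen:
  assumes "tame g" "D < c"
  shows "neumann c (\<lambda>x. c * g x - gen g x) x = g x"
proof -
  have c: "0 < c" using assms(2) D_nonneg by linarith
  obtain B where B: "0 \<le> B" "\<And>k. (gen ^^ k) (\<lambda>z. \<bar>g z\<bar>) x \<le> B * D ^ k"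
    by (rule tameE[OF assms(1), where x = x]) (rule that)
  have "(\<lambda>k. (gen ^^ k) g x / c ^ k) \<longlonglongrightarrow> 0"
  proof (rule Lim_null_comparison)
    have "(\<lambda>k. (D / c) ^ k) \<longlonglongrightarrow> 0"
      using c D_nonneg assms(2) by (intro LIMSEQ_realpow_zero) auto
    then show "(\<lambda>k. B * (D / c) ^ k) \<longlonglongrightarrow> 0"
      by (rule tendsto_mult_right_zero)
    have "norm ((gen ^^ k) g x / c ^ k) \<le> B * (D / c) ^ k" for k
    proof -
      have "\<bar>(gen ^^ k) g x\<bar> \<le> B * D ^ k"
        using geniter_abs_le B(2) by (rule order_trans)
      then have "\<bar>(gen ^^ k) g x\<bar> / c ^ k \<le> B * D ^ k / c ^ k"
        using c by (intro divide_right_mono) auto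
      then show ?thesis using c by (simp add: power_divide)
    qed
    then show "\<forall>\<^sub>F k in sequentially. norm ((gen ^^ k) g x / c ^ k) \<le> B * (D / c) ^ k"
      by simp
  qed
  from telescope_sums'[OF this]
  have "(\<lambda>k. (gen ^^ k) g x / c ^ k - (gen ^^ Suc k) g x / c ^ Suc k) sums g x"
    by simp
  moreover have "(gen ^^ k) (\<lambda>x. c * g x - gen g x) x / c ^ Suc k
      = (gen ^^ k) g x / c ^ k - (gen ^^ Suc k) g x / c ^ Suc k" for k
  proof -
    have "(gen ^^ k) (\<lambda>x. c * g x + - 1 * gen g x) x = c * (gen ^^ k) g x + - 1 * (gen ^^ Suc k) g x"
      by (simp only: geniter_add geniter_cmult geniter_Suc_right)
    then show ?thesis using c by (simp add: diff_divide_distrib)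
  qed
  ultimately show ?thesis
    unfolding neumann_def by (simp add: sums_iff)
qed

text \<open>Cauchy-Schwarz for the positive operator \<open>neumann c\<close>, which sends 1 to
  \<open>1 / (c - D)\<close>.\<close>

lemma neumann_square_le:
  assumes "tame g" "tame (\<lambda>x. (g x)\<^sup>2)" "D < c"
  shows "(neumann c g x)\<^sup>2 \<le> 1 / (c - D) * neumann c (\<lambda>x. (g x)\<^sup>2) x"
proof (rule discriminant_le)
  have c: "0 < c" using assms(3) D_nonneg by linarith
  fix a
  have "(\<lambda>k. (gen ^^ k) (\<lambda>x. (g x)\<^sup>2) x / c ^ Suc k
      - 2 * a * ((gen ^^ k) g x / c ^ Suc k) + a\<^sup>2 * (D ^ k / c ^ Suc k))
    sums (neumann c (\<lambda>x. (g x)\<^sup>2) x - 2 * a * neumann c g x + a\<^sup>2 * (1 / (c - D)))"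
    by (intro sums_add sums_diff sums_mult neumann_sums neumann_const_sums assms)
  moreover have "0 \<le> (gen ^^ k) (\<lambda>x. (g x)\<^sup>2) x / c ^ Suc k
      - 2 * a * ((gen ^^ k) g x / c ^ Suc k) + a\<^sup>2 * (D ^ k / c ^ Suc k)" for k
  proof -
    have "0 \<le> (gen ^^ k) (\<lambda>x. (g x - a)\<^sup>2) x / c ^ Suc k"
      using c by (intro divide_nonneg_nonneg geniter_nonneg) auto
    then show ?thesis
      by (simp add: geniter_square_expand diff_divide_distrib add_divide_distrib)
  qed
  ultimately show "0 \<le> neumann c (\<lambda>x. (g x)\<^sup>2) x - 2 * a * neumann c g x + a\<^sup>2 * (1 / (c - D))"
    by (metis (no_types, lifting) sums_le sums_zero)
qed (use assms in simp)

text \<open>One factor \<open>1 / (c - D)\<close> comes from Cauchy-Schwarz, the other from summing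
  the mass bounds \<open>D ^ k\<close> for the iterates of the squared function.\<close>

lemma neumann_l2:
  assumes g: "g \<in> lp_space m 2" and c: "D < c"
  shows "neumann c g \<in> lp_space m 2" "(l2_norm m (neumann c g))\<^sup>2 \<le> (1 / (c - D) * l2_norm m g)\<^sup>2"
proof -
  have bound: "(\<Sum>x\<in>F. m x * (neumann c g x)\<^sup>2) \<le> (1 / (c - D) * l2_norm m g)\<^sup>2" if F: "finite F" for F :: "'v set"
  proof -
    have c0: "0 < c" using c D_nonneg by linarith
    have "(\<Sum>x\<in>F. m x * neumann c (\<lambda>x. (g x)\<^sup>2) x) \<le> 1 / (c - D) * (l2_norm m g)\<^sup>2"
    proof (rule sums_le)
      show "(\<lambda>k. \<Sum>x\<in>F. m x * ((gen ^^ k) (\<lambda>x. (g x)\<^sup>2) x / c ^ Suc k)) sums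
          (\<Sum>x\<in>F. m x * neumann c (\<lambda>x. (g x)\<^sup>2) x)"
        by (intro sums_sum sums_mult neumann_sums tame_l2(2) g c)
      show "(\<lambda>k. D ^ k / c ^ Suc k * (l2_norm m g)\<^sup>2) sums (1 / (c - D) * (l2_norm m g)\<^sup>2)"
        by (intro sums_mult2 neumann_const_sums c)
      fix k
      have "(\<Sum>x\<in>F. m x * (gen ^^ k) (\<lambda>x. (g x)\<^sup>2) x) / c ^ Suc k \<le> D ^ k * (l2_norm m g)\<^sup>2 / c ^ Suc k"
        using sum_le_l2_norm[OF g] F c0 by (intro divide_right_mono sum_geniter_le) auto
      then show "(\<Sum>x\<in>F. m x * ((gen ^^ k) (\<lambda>x. (g x)\<^sup>2) x / c ^ Suc k)) \<le> D ^ k / c ^ Suc k * (l2_norm m g)\<^sup>2"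
        by (simp add: sum_divide_distrib)
    qed
    then have "1 / (c - D) * (\<Sum>x\<in>F. m x * neumann c (\<lambda>x. (g x)\<^sup>2) x)
        \<le> 1 / (c - D) * (1 / (c - D) * (l2_norm m g)\<^sup>2)"
      using c by (intro mult_left_mono) auto
    moreover have "(\<Sum>x\<in>F. m x * (neumann c g x)\<^sup>2)
        \<le> (\<Sum>x\<in>F. m x * (1 / (c - D) * neumann c (\<lambda>x. (g x)\<^sup>2) x))"
      using measure_pos[THEN less_imp_le] tame_l2[OF g] c
      by (intro sum_mono mult_left_mono neumann_square_le) auto
    moreover have "(\<Sum>x\<in>F. m x * (1 / (c - D) * neumann c (\<lambda>x. (g x)\<^sup>2) x))
        = 1 / (c - D) * (\<Sum>x\<in>F. m x * neumann c (\<lambda>x. (g x)\<^sup>2) x)"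
      by (simp only: sum_distrib_left mult.left_commute)
    ultimately show ?thesis
      by (simp add: power2_eq_square)
  qed
  show "neumann c g \<in> lp_space m 2"
    using bound by (rule l2I(1))
  show "(l2_norm m (neumann c g))\<^sup>2 \<le> (1 / (c - D) * l2_norm m g)\<^sup>2"
    using bound by (rule l2I(2))
qed

text \<open>This bounds the spectrum below, so that its \<open>Inf\<close> is a genuine lower
  bound.\<close>

lemma negative_in_resolvent:
  assumes "l < 0"
  shows "l \<in> l2_resolvent_set m (\<lambda>f x. - \<Delta> f x)"
proof -
  define c where "c = D - l"
  have c: "D < c" using assms by (simp add: c_def)
  have T: "- \<Delta> f x - l * f x = c * f x - gen f x" for f x
    by (simp add: gen_def c_def left_diff_distrib)
  have "bij_betw (\<lambda>f x. c * f x - gen f x) (lp_space m 2) (lp_space m 2)"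
  proof (rule bij_betwI[where g = "neumann c"])
    show "(\<lambda>f x. c * f x - gen f x) \<in> lp_space m 2 \<rightarrow> lp_space m 2"
      by (intro funcsetI l2_combine gen_l2)
    show "neumann c \<in> lp_space m 2 \<rightarrow> lp_space m 2"
      by (intro funcsetI neumann_l2 c)
    show "neumann c (\<lambda>x. c * f x - gen f x) = f" if "f \<in> lp_space m 2" for f
      using neumann_gen[OF tame_l2(1)[OF that] c] by blast
    show "(\<lambda>x. c * neumann c f x - gen (neumann c f) x) = f" if "f \<in> lp_space m 2" for f
      by (rule ext) (simp add: gen_neumann[OF tame_l2(1)[OF that] c])
  qed
  moreover have "l2_norm m f \<le> 1 / (c - D) * l2_norm m (\<lambda>x. c * f x - gen f x)"
    if "f \<in> lp_space m 2" for f
  proof (rule power2_le_imp_le)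
    have "neumann c (\<lambda>x. c * f x - gen f x) = f"
      using neumann_gen[OF tame_l2(1)[OF that] c] by blast
    then show "(l2_norm m f)\<^sup>2 \<le> (1 / (c - D) * l2_norm m (\<lambda>x. c * f x - gen f x))\<^sup>2"
      using neumann_l2(2)[OF l2_combine[OF that gen_l2[OF that]] c, of c] by simp
    show "0 \<le> 1 / (c - D) * l2_norm m (\<lambda>x. c * f x - gen f x)"
      using c l2_norm_nonneg by (intro mult_nonneg_nonneg) auto
  qed
  moreover have "(\<lambda>f x. - \<Delta> f x - l * f x) = (\<lambda>f x. c * f x - gen f x)"
    by (intro ext T)
  ultimately show ?thesis
    unfolding l2_resolvent_set_def mem_Collect_eq T by metis
qed

end

section \<open>The bottom of the spectrum and the Rayleigh quotient\<close>

context weighted_graph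
begin

lemma rayleigh_bound_antimono:
  assumes "rayleigh_bound l'" "l \<le> l'"
  shows "rayleigh_bound l"
  unfolding rayleigh_bound_def
proof (intro allI impI)
  fix S and g :: "'v \<Rightarrow> real"
  assume S: "finite S" "\<forall>x. x \<notin> S \<longrightarrow> g x = 0"
  have "l * (\<Sum>x\<in>S. m x * (g x)\<^sup>2) \<le> l' * (\<Sum>x\<in>S. m x * (g x)\<^sup>2)"
    using assms(2) measure_pos[THEN less_imp_le]
    by (intro mult_right_mono sum_nonneg mult_nonneg_nonneg) auto
  also have "\<dots> \<le> - (\<Sum>x\<in>S. m x * (g x * \<Delta> g x))"
    using assms(1) S unfolding rayleigh_bound_def by blast
  finally show "l * (\<Sum>x\<in>S. m x * (g x)\<^sup>2) \<le> - (\<Sum>x\<in>S. m x * (g x * \<Delta> g x))" .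
qed

text \<open>From (a - b)^2 \<le> 2 a^2 + 2 b^2 and the degree bound.\<close>

lemma dirichlet_form_le:
  assumes "finite S" "nbhd \<Omega> \<subseteq> S" "\<And>x. x \<notin> \<Omega> \<Longrightarrow> h x = 0"
  shows "- (\<Sum>x\<in>S. m x * (h x * \<Delta> h x)) \<le> 2 * D * (\<Sum>x\<in>S. m x * (h x)\<^sup>2)"
proof -
  have "- (2 * (\<Sum>x\<in>S. m x * (h x * \<Delta> h x))) = (\<Sum>x\<in>S. \<Sum>y\<in>S. w x y * ((h x - h y) * (h x - h y)))"
    using green_formula[OF assms(1,2), of h h, OF assms(3)] by simp
  also have "\<dots> \<le> (\<Sum>x\<in>S. \<Sum>y\<in>S. w x y * (2 * (h x)\<^sup>2 + 2 * (h y)\<^sup>2))"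
  proof (intro sum_mono mult_left_mono weight_nonneg)
    fix x y
    show "(h x - h y) * (h x - h y) \<le> 2 * (h x)\<^sup>2 + 2 * (h y)\<^sup>2"
      using zero_le_power2[of "h x + h y"] by (simp add: power2_eq_square algebra_simps)
  qed
  also have "\<dots> = 2 * (\<Sum>x\<in>S. \<Sum>y\<in>S. w x y * (2 * (h x)\<^sup>2))"
    by (rule sum_symmetrize[symmetric])
  also have "\<dots> = 2 * (\<Sum>x\<in>S. (\<Sum>y\<in>S. w x y) * (2 * (h x)\<^sup>2))"
    by (simp only: sum_distrib_right)
  also have "\<dots> \<le> 2 * (\<Sum>x\<in>S. (D * m x) * (2 * (h x)\<^sup>2))"
    using order_trans[OF sum_weight_le[OF assms(1)] weighted_deg_le]
    by (intro mult_left_mono sum_mono mult_right_mono) auto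
  also have "\<dots> = 2 * (2 * D * (\<Sum>x\<in>S. m x * (h x)\<^sup>2))"
    by (simp add: sum_distrib_left mult_ac)
  finally show ?thesis by simp
qed

text \<open>Testing the
  nonnegative form \<open>\<langle>(-\<Delta> - l)g, g\<rangle>\<close> with \<open>g = f - \<epsilon>(-\<Delta> - l)f\<close> bounds \<open>\<parallel>(-\<Delta> - l)f\<parallel>\<^sup>2\<close> by a multiple of
  \<open>\<langle>(-\<Delta> - l)f, f\<rangle>\<close>.\<close>

lemma rayleigh_bound_improve:
  assumes l: "0 \<le> l" "rayleigh_bound l"
    and C: "\<And>f. f \<in> lp_space m 2 \<Longrightarrow> l2_norm m f \<le> C * l2_norm m (\<lambda>x. - \<Delta> f x - l * f x)"
  shows "\<exists>e>0. rayleigh_bound (l + e)"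
proof -
  \<comment> \<open>\<open>2 * D\<close> bounds the form of -\<Delta>; the added 1 keeps
    \<open>M\<close> positive even for \<open>D = 0\<close>.\<close>
  define M where "M = 2 * D + 1"
  \<comment> \<open>The argument ends with the squared norm of \<open>f\<close> bounded by
    \<open>C\<^sup>2 * M\<close> times \<open>ip f h\<close>, so \<open>1 / K\<close> can be gained;
    the 1 again secures positivity.\<close>
  define K where "K = C\<^sup>2 * M + 1"
  have M: "0 < M" and K: "0 < K"
    using D_nonneg by (auto simp: M_def K_def intro!: add_nonneg_pos mult_nonneg_nonneg)
  have "rayleigh_bound (l + 1 / K)"
    unfolding rayleigh_bound_def
  proof (intro allI impI)
    fix S and f :: "'v \<Rightarrow> real"
    assume S: "finite S" and f: "\<forall>x. x \<notin> S \<longrightarrow> f x = 0"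
    \<comment> \<open>Applying the operator to \<open>f\<close> spreads the support from
      \<open>S\<close> to \<open>U\<close>, and Green's formula for functions supported in
      \<open>U\<close> needs \<open>W\<close>.\<close>
    define U W where "U = nbhd S" and "W = nbhd U"
    have fin: "finite U" "finite W" and sub: "S \<subseteq> U" "U \<subseteq> W"
      unfolding U_def W_def using S finite_nbhd subset_nbhd by auto
    define B where "B k x = - \<Delta> k x - l * k x" for k x
    define h where "h = B f"
    have fU: "f x = 0" if "x \<notin> U" for x using f sub that by auto
    have h: "h x = 0" if "x \<notin> U" for x
    proof -
      have "f y = 0" if "y \<in> E `` {x}" for y
      proof (rule ccontr)
        assume "f y \<noteq> 0"
        then have "y \<in> S" using f by blast
        moreover have "x \<in> E `` {y}" using \<open>y \<in> E `` {x}\<close> edge_sym by auto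
        ultimately show False
          using neighbours_subset_nbhd[of y S] \<open>x \<notin> U\<close> unfolding U_def by blast
      qed
      then show ?thesis using fU[OF that] by (simp add: h_def B_def laplacian_def)
    qed
    define ip where "ip k k' = (\<Sum>x\<in>W. m x * (k x * k' x))" for k k'
    have sym: "ip k (B k') = ip k' (B k)"
      if "\<And>x. x \<notin> U \<Longrightarrow> k x = 0" "\<And>x. x \<notin> U \<Longrightarrow> k' x = 0" for k k'
    proof -
      have "ip k (\<Delta> k') = ip k' (\<Delta> k)"
        using green_formula[OF fin(2) eq_refl[OF W_def[symmetric]], of k k', OF that(1)]
          green_formula[OF fin(2) eq_refl[OF W_def[symmetric]], of k' k, OF that(2)]
        by (simp add: ip_def mult.commute)
      moreover have "ip k (B k') = - ip k (\<Delta> k') - l * ip k k'" for k k'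
        by (simp add: ip_def B_def right_diff_distrib sum_subtractf sum_negf sum_distrib_left mult_ac)
      ultimately show ?thesis by (simp add: ip_def mult.commute)
    qed
    have ipB: "ip k (B k) = - (\<Sum>x\<in>W. m x * (k x * \<Delta> k x)) - l * (\<Sum>x\<in>W. m x * (k x)\<^sup>2)" for k
      by (simp add: ip_def B_def right_diff_distrib sum_subtractf sum_negf sum_distrib_left power2_eq_square mult_ac)
    have pos: "0 \<le> ip k (B k)" if "\<And>x. x \<notin> U \<Longrightarrow> k x = 0" for k
      using l(2)[unfolded rayleigh_bound_def, rule_format, OF fin(2), of k] that sub
      by (auto simp: ipB)
    have hh_nonneg: "0 \<le> ip h h"
      unfolding ip_def using measure_pos[THEN less_imp_le] by (intro sum_nonneg mult_nonneg_nonneg[OF _ zero_le_square])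
    have upper: "ip h (B h) \<le> M * ip h h"
    proof -
      have "ip h (B h) \<le> 2 * D * (\<Sum>x\<in>W. m x * (h x)\<^sup>2) - l * (\<Sum>x\<in>W. m x * (h x)\<^sup>2)"
        unfolding ipB
        using dirichlet_form_le[OF fin(2) eq_refl[OF W_def[symmetric]], of h, OF h] by simp
      also have "\<dots> \<le> M * ip h h"
        using l(1) hh_nonneg by (simp add: ip_def M_def power2_eq_square distrib_right add_increasing2)
      finally show ?thesis .
    qed
    \<comment> \<open>Then \<open>\<epsilon>\<^sup>2 * M = \<epsilon>\<close>, so one of the two
      negative terms \<open>\<epsilon> * ip h h\<close> survives the quadratic one.\<close>
    define \<epsilon> where "\<epsilon> = 1 / M"
    define g where "g x = f x - \<epsilon> * h x" for x
    have Bg: "B g x = h x - \<epsilon> * B h x" for x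
      unfolding B_def g_def laplacian_diff h_def by (simp add: algebra_simps)
    have "ip g (B g) = (\<Sum>x\<in>W. m x * ((f x - \<epsilon> * h x) * (h x - \<epsilon> * B h x)))"
      unfolding ip_def Bg by (simp add: g_def)
    also have "\<dots> = ip f h - \<epsilon> * ip h h - \<epsilon> * ip f (B h) + \<epsilon>\<^sup>2 * ip h (B h)"
      by (simp add: ip_def algebra_simps sum_subtractf sum.distrib sum_distrib_left power2_eq_square)
    finally have "ip g (B g) = ip f h - \<epsilon> * ip h h - \<epsilon> * ip f (B h) + \<epsilon>\<^sup>2 * ip h (B h)" .
    moreover have "0 \<le> ip g (B g)"
      by (rule pos) (simp add: g_def fU h)
    moreover have "\<epsilon> * ip f (B h) = \<epsilon> * ip h h"
      using sym[of f h] fU h by (simp add: h_def)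
    moreover have "\<epsilon>\<^sup>2 * ip h (B h) \<le> \<epsilon>\<^sup>2 * (M * ip h h)"
      using upper by (intro mult_left_mono) auto
    moreover have "\<epsilon>\<^sup>2 * (M * ip h h) = \<epsilon> * ip h h"
      using M by (simp add: \<epsilon>_def power2_eq_square)
    ultimately have "\<epsilon> * ip h h \<le> ip f h" by linarith
    then have hf: "ip h h \<le> M * ip f h"
      using M by (simp add: \<epsilon>_def field_simps)
    have "(l2_norm m f)\<^sup>2 \<le> (C * l2_norm m h)\<^sup>2"
      using C[OF l2_finite_support(1)[OF S, of f]] f l2_norm_nonneg
      by (intro power_mono) (auto simp: h_def B_def[abs_def])
    also have "\<dots> = C\<^sup>2 * ip h h"
      using l2_finite_support(2)[OF fin(2), of h] h sub
      by (auto simp: power_mult_distrib ip_def power2_eq_square)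
    also have "\<dots> \<le> C\<^sup>2 * (M * ip f h)"
      using hf by (intro mult_left_mono) auto
    also have "\<dots> \<le> K * ip f h"
      using pos[of f] fU by (simp add: K_def h_def distrib_right mult.assoc)
    finally have "(\<Sum>x\<in>S. m x * (f x)\<^sup>2) / K \<le> ip f h"
      using K l2_finite_support(2)[OF S, of f] f by (simp add: field_simps)
    also have "ip f h = - (\<Sum>x\<in>S. m x * (f x * \<Delta> f x)) - l * (\<Sum>x\<in>S. m x * (f x)\<^sup>2)"
    proof -
      have "(\<Sum>x\<in>W. m x * (f x * \<Delta> f x)) = (\<Sum>x\<in>S. m x * (f x * \<Delta> f x))"
        "(\<Sum>x\<in>W. m x * (f x)\<^sup>2) = (\<Sum>x\<in>S. m x * (f x)\<^sup>2)"
        by (rule sum.mono_neutral_right; use fin sub f in auto)+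
      then show ?thesis unfolding h_def ipB by simp
    qed
    finally show "(l + 1 / K) * (\<Sum>x\<in>S. m x * (f x)\<^sup>2) \<le> - (\<Sum>x\<in>S. m x * (f x * \<Delta> f x))"
      by (simp add: distrib_right)
  qed
  then show ?thesis using K by (intro exI[of _ "1 / K"]) simp
qed

text \<open>The largest admissible constant \<open>l\<^sub>0\<close> is spectral, since a bounded
  inverse would allow a larger one. Hence the bottom of the spectrum is at most
  \<open>l\<^sub>0\<close>, and smaller constants remain admissible.\<close>

lemma rayleigh_bound_spectrum_bottom: "rayleigh_bound (spectrum_bottom E w m)"
proof -
  define Q where "Q = {l. rayleigh_bound l}"
  \<comment> \<open>A Dirac test function shows that the admissible constants are bounded
    above.\<close>
  have le_D: "l \<le> 2 * D" if l: "rayleigh_bound l" for l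
  proof -
    fix x :: 'v
    let ?g = "dirac x"
    have g: "?g z = 0" if "z \<notin> {x}" for z using that by (simp add: dirac_def)
    have fin: "finite (nbhd {x})" by (simp add: finite_nbhd)
    have "l * (\<Sum>z\<in>nbhd {x}. m z * (?g z)\<^sup>2) \<le> - (\<Sum>z\<in>nbhd {x}. m z * (?g z * \<Delta> ?g z))"
      using l[unfolded rayleigh_bound_def, rule_format, OF fin] g subset_nbhd[of "{x}"] by blast
    also have "\<dots> \<le> 2 * D * (\<Sum>z\<in>nbhd {x}. m z * (?g z)\<^sup>2)"
      by (rule dirichlet_form_le[OF fin order_refl g])
    finally have "l * (\<Sum>z\<in>nbhd {x}. m z * (?g z)\<^sup>2) \<le> 2 * D * (\<Sum>z\<in>nbhd {x}. m z * (?g z)\<^sup>2)" .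
    moreover have "(\<Sum>z\<in>nbhd {x}. m z * (?g z)\<^sup>2) = (\<Sum>z\<in>{x}. m z * (?g z)\<^sup>2)"
      by (rule sum.mono_neutral_right) (use fin subset_nbhd[of "{x}"] g in auto)
    ultimately show ?thesis
      using measure_pos[of x] by (simp add: dirac_def)
  qed
  have bdd: "bdd_above Q" unfolding Q_def using le_D by (intro bdd_aboveI) auto
  have zero: "0 \<in> Q" by (simp add: Q_def rayleigh_bound_0)
  define l\<^sub>0 where "l\<^sub>0 = Sup Q"
  have l0: "rayleigh_bound l\<^sub>0"
    unfolding rayleigh_bound_def
  proof (intro allI impI)
    fix S and g :: "'v \<Rightarrow> real"
    assume S: "finite S" "\<forall>x. x \<notin> S \<longrightarrow> g x = 0"
    let ?N = "\<Sum>x\<in>S. m x * (g x)\<^sup>2"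
    have le: "l * ?N \<le> - (\<Sum>x\<in>S. m x * (g x * \<Delta> g x))" if "l \<in> Q" for l
      using that S unfolding Q_def rayleigh_bound_def by blast
    have "0 \<le> ?N" using measure_pos[THEN less_imp_le] by (intro sum_nonneg mult_nonneg_nonneg) auto
    \<comment> \<open>The bound is linear in the constant, so for positive \<open>?N\<close> it
      passes to the supremum after division; for \<open>?N = 0\<close> the constant 0
      suffices.\<close>
    show "l\<^sub>0 * ?N \<le> - (\<Sum>x\<in>S. m x * (g x * \<Delta> g x))"
    proof (cases "?N = 0")
      case True
      then show ?thesis using le[OF zero] by simp
    next
      case False
      with \<open>0 \<le> ?N\<close> have "0 < ?N" by simp
      have "l\<^sub>0 \<le> - (\<Sum>x\<in>S. m x * (g x * \<Delta> g x)) / ?N"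
        unfolding l\<^sub>0_def
      proof (rule cSup_least)
        show "Q \<noteq> {}" using zero by blast
        show "l \<le> - (\<Sum>x\<in>S. m x * (g x * \<Delta> g x)) / ?N" if "l \<in> Q" for l
          using le[OF that] by (simp only: pos_le_divide_eq[OF \<open>0 < ?N\<close>])
      qed
      then show ?thesis by (simp only: pos_le_divide_eq[OF \<open>0 < ?N\<close>])
    qed
  qed
  have nonneg: "0 \<le> l\<^sub>0"
    unfolding l\<^sub>0_def by (rule cSup_upper[OF zero bdd])
  have "l\<^sub>0 \<in> l2_spectrum m (\<lambda>f x. - \<Delta> f x)"
  proof (rule ccontr)
    assume "l\<^sub>0 \<notin> l2_spectrum m (\<lambda>f x. - \<Delta> f x)"
    then obtain C where "\<And>f. f \<in> lp_space m 2 \<Longrightarrow> l2_norm m f \<le> C * l2_norm m (\<lambda>x. - \<Delta> f x - l\<^sub>0 * f x)"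
      unfolding l2_spectrum_def l2_resolvent_set_def by blast
    from rayleigh_bound_improve[OF nonneg l0 this]
    obtain e where e: "0 < e" "l\<^sub>0 + e \<in> Q" unfolding Q_def by blast
    then have "l\<^sub>0 + e \<le> l\<^sub>0" using cSup_upper[OF e(2) bdd] by (simp add: l\<^sub>0_def)
    with e(1) show False by simp
  qed
  moreover have "bdd_below (l2_spectrum m (\<lambda>f x. - \<Delta> f x))"
  proof (rule bdd_belowI)
    fix l assume "l \<in> l2_spectrum m (\<lambda>f x. - \<Delta> f x)"
    then show "0 \<le> l"
      using negative_in_resolvent[of l] unfolding l2_spectrum_def by (cases "l < 0") auto
  qed
  ultimately have "spectrum_bottom E w m \<le> l\<^sub>0"
    unfolding spectrum_bottom_def by (rule cInf_lower)
  with l0 show ?thesis by (rule rayleigh_bound_antimono)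
qed

end

section \<open>Monotonicity of the weighted energy\<close>

context weighted_graph
begin

lemma heat_weighted_energy_le:
  assumes f: "tame f" and st: "0 \<le> s" "s \<le> t"
    and K: "\<And>t x. 0 \<le> t \<Longrightarrow> 0 \<le> K t x" and K': "\<And>t x. 0 \<le> t \<Longrightarrow> K' t x \<le> 0"
    and K_deriv: "\<And>t x. 0 \<le> t \<Longrightarrow> ((\<lambda>s. K s x) has_real_derivative K' t x) (at t within {0..})"
    and \<gamma>: "0 \<le> \<gamma>" "\<gamma> \<le> 1"
    and ineq: "\<And>t x y. 0 \<le> t \<Longrightarrow> (x, y) \<in> E \<Longrightarrow>
      (K t x + K t y - 2 * (1 - \<gamma>) * sqrt (K t x * K t y))\<^sup>2
      \<le> (1 / D * K' t x - 2 * \<gamma> * K t x) * (1 / D * K' t y - 2 * \<gamma> * K t y)"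
    and l: "rayleigh_bound l"
  shows "ennreal (exp (2 * (1 - \<gamma>) * l * t)) * (\<Sum>\<^sub>\<infinity>x. ennreal (K t x * (heat UNIV f t x)\<^sup>2 * m x))
    \<le> ennreal (exp (2 * (1 - \<gamma>) * l * s)) * (\<Sum>\<^sub>\<infinity>x. ennreal (K s x * (heat UNIV f s x)\<^sup>2 * m x))"
    (is "ennreal ?et * ?It \<le> ennreal ?es * ?Is")
proof -
  define g where "g = heat UNIV f s"
  define \<tau> where "\<tau> = t - s"
  have \<tau>: "0 \<le> \<tau>" "t = s + \<tau>" using st by (simp_all add: \<tau>_def)
  have g: "tame g" unfolding g_def by (rule tame_heat[OF f st(1)])
  have ft: "heat UNIV f t x = heat UNIV g \<tau> x" for x
    unfolding g_def \<tau>(2) using heat_heat[OF f st(1) \<tau>(1)] by simp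
  obtain \<Omega> :: "nat \<Rightarrow> 'v set" where \<Omega>: "exhaustion \<Omega>" using exhaustion_exists ..
  have fin: "finite (\<Omega> n)" for n using \<Omega> by (simp add: exhaustion_def)
  \<comment> \<open>Translation by \<open>s\<close> maps \<open>{0..}\<close> into itself, so the
    one-sided derivatives carry over, also at \<open>r = 0\<close>.\<close>
  have Kd: "((\<lambda>r. K (s + r) x) has_real_derivative K' (s + r) x) (at r within {0..})" if "0 \<le> r" for r x
  proof -
    have "((\<lambda>r. s + r) has_real_derivative 1) (at r within {0..})"
      by (rule derivative_eq_intros refl | simp)+
    moreover have "((\<lambda>q. K q x) has_real_derivative K' (s + r) x) (at (s + r) within (\<lambda>r. s + r) ` {0..})"
      by (rule has_field_derivative_subset[OF K_deriv]) (use that st in auto)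
    ultimately show ?thesis
      using DERIV_image_chain by (fastforce simp: o_def)
  qed
  \<comment> \<open>Dirichlet flow on \<open>\<Omega> n\<close> started from the truncation of the
    solution at time \<open>s\<close>, with the weight read at the shifted time.\<close>
  have approx: "exp (2 * (1 - \<gamma>) * l * \<tau>) * (\<Sum>x\<in>\<Omega> n. m x * (K (s + \<tau>) x * (heat (\<Omega> n) g \<tau> x)\<^sup>2))
      \<le> (\<Sum>x\<in>\<Omega> n. m x * (K (s + 0) x * (heat (\<Omega> n) g 0 x)\<^sup>2))" for n
  proof (rule weighted_energy_decreasing[OF fin _ _ l, where K' = "\<lambda>r. K' (s + r)"])
    show "((\<lambda>r. heat (\<Omega> n) g r x) has_real_derivative \<Delta> (heat (\<Omega> n) g r) x) (at r within {0..})"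
      if "x \<in> \<Omega> n" for r x
      using heat_deriv[OF g that] by (rule has_field_derivative_at_within)
  qed (use st \<tau> K K' Kd \<gamma> ineq heat_outside in auto)
  \<comment> \<open>Fatou by hand: \<open>F\<close> stays fixed while \<open>n\<close> tends to
    infinity, and the supremum over \<open>F\<close> is taken last.\<close>
  have finite_le: "ennreal ?et * (\<Sum>x\<in>F. ennreal (K t x * (heat UNIV f t x)\<^sup>2 * m x)) \<le> ennreal ?es * ?Is"
    if F: "finite F" for F
  proof -
    define R where "R n = ?et * (\<Sum>x\<in>F. K t x * (heat (\<Omega> n) g \<tau> x)\<^sup>2 * m x)" for n
    have nn: "0 \<le> K r x * a\<^sup>2 * m x" if "0 \<le> r" for r x a
      using K[OF that] measure_pos[of x] by (intro mult_nonneg_nonneg) auto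
    have "R \<longlonglongrightarrow> ?et * (\<Sum>x\<in>F. K t x * (heat UNIV f t x)\<^sup>2 * m x)"
      unfolding R_def ft by (intro tendsto_intros heat_exhaustion \<Omega> g)
    then have lim: "(\<lambda>n. ennreal (R n)) \<longlonglongrightarrow> ennreal (?et * (\<Sum>x\<in>F. K t x * (heat UNIV f t x)\<^sup>2 * m x))"
      by (rule tendsto_ennrealI)
    have "ennreal (R n) \<le> ennreal ?es * ?Is" if sub: "F \<subseteq> \<Omega> n" for n
    proof -
      have "?et = ?es * exp (2 * (1 - \<gamma>) * l * \<tau>)"
        unfolding \<tau>(2) by (simp add: exp_add[symmetric] distrib_left)
      then have "R n = ?es * (exp (2 * (1 - \<gamma>) * l * \<tau>) * (\<Sum>x\<in>F. m x * (K t x * (heat (\<Omega> n) g \<tau> x)\<^sup>2)))"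
        unfolding R_def by (simp add: mult_ac)
      also have "\<dots> \<le> ?es * (exp (2 * (1 - \<gamma>) * l * \<tau>) * (\<Sum>x\<in>\<Omega> n. m x * (K t x * (heat (\<Omega> n) g \<tau> x)\<^sup>2)))"
        using nn[of t] st sub fin by (intro mult_left_mono sum_mono2) (auto simp: mult_ac)
      also have "\<dots> \<le> ?es * (\<Sum>x\<in>\<Omega> n. m x * (K s x * (heat (\<Omega> n) g 0 x)\<^sup>2))"
        using approx[of n] \<tau>(2) by (intro mult_left_mono) auto
      also have "\<dots> = ?es * (\<Sum>x\<in>\<Omega> n. K s x * (heat UNIV f s x)\<^sup>2 * m x)"
        by (simp add: heat_0 g_def mult_ac)
      finally have "ennreal (R n) \<le> ennreal ?es * ennreal (\<Sum>x\<in>\<Omega> n. K s x * (heat UNIV f s x)\<^sup>2 * m x)"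
        using nn[OF st(1)] by (simp add: ennreal_mult[symmetric] sum_nonneg ennreal_leI)
      also have "ennreal (\<Sum>x\<in>\<Omega> n. K s x * (heat UNIV f s x)\<^sup>2 * m x)
          = (\<Sum>x\<in>\<Omega> n. ennreal (K s x * (heat UNIV f s x)\<^sup>2 * m x))"
        using nn[OF st(1)] by (simp add: sum_ennreal)
      \<comment> \<open>In \<open>ennreal\<close> an infinite sum is the supremum of its finite
        subsums, so an infinite energy at time \<open>s\<close> is covered.\<close>
      also have "ennreal ?es * \<dots> \<le> ennreal ?es * ?Is"
        by (intro mult_left_mono) (use fin in \<open>auto simp: nonneg_infsum_complete intro!: SUP_upper\<close>)
      finally show ?thesis .
    qed
    moreover have "\<forall>\<^sub>F n in sequentially. F \<subseteq> \<Omega> n"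
      using F exhaustion_eventually_mem[OF \<Omega>] by (simp add: subset_eq eventually_ball_finite)
    ultimately have "\<forall>\<^sub>F n in sequentially. ennreal (R n) \<le> ennreal ?es * ?Is"
      by (auto elim: eventually_mono)
    then have "ennreal (?et * (\<Sum>x\<in>F. K t x * (heat UNIV f t x)\<^sup>2 * m x)) \<le> ennreal ?es * ?Is"
      using tendsto_upperbound[OF lim] by simp
    also have "ennreal (?et * (\<Sum>x\<in>F. K t x * (heat UNIV f t x)\<^sup>2 * m x))
        = ennreal ?et * (\<Sum>x\<in>F. ennreal (K t x * (heat UNIV f t x)\<^sup>2 * m x))"
      using nn[of t] st by (simp add: ennreal_mult sum_nonneg sum_ennreal)
    finally show ?thesis .
  qed
  have "ennreal ?et * ?It = (SUP F\<in>{F. finite F \<and> F \<subseteq> UNIV}.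
      ennreal ?et * (\<Sum>x\<in>F. ennreal (K t x * (heat UNIV f t x)\<^sup>2 * m x)))"
    by (subst nonneg_infsum_complete) (auto simp: SUP_mult_left_ennreal)
  also have "\<dots> \<le> ennreal ?es * ?Is"
    by (rule SUP_least) (use finite_le in auto)
  finally show ?thesis .
qed

end

text \<open>Difference quotients from the right are nonpositive; approaching within
  \<open>{t..}\<close> treats the endpoint 0 like any other time.\<close>

lemma antimono_on_derivative_nonpos:
  fixes f :: "real \<Rightarrow> real"
  assumes "antimono_on {0..} f" "0 \<le> t" "(f has_real_derivative d) (at t within {0..})"
  shows "d \<le> 0"
proof (rule tendsto_upperbound)
  have "at t within {t..} \<le> at t within {0..}"
    by (rule at_le) (use assms(2) in auto)
  then show "((\<lambda>y. (f y - f t) / (y - t)) \<longlongrightarrow> d) (at t within {t..})"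
    using assms(3) unfolding has_field_derivative_iff by (rule tendsto_mono)
  show "\<forall>\<^sub>F y in at t within {t..}. (f y - f t) / (y - t) \<le> 0"
    using assms(1,2)
    by (auto simp: eventually_at_filter divide_nonpos_pos monotone_on_def intro!: always_eventually divide_nonpos_nonneg)
  show "at t within {t..} \<noteq> bot"
    by (simp add: at_within_Ici_at_right)
qed

theorem lemma3p2:
  fixes E :: "('v \<times> 'v) set"
    and w :: "'v \<Rightarrow> 'v \<Rightarrow> real"
    and m :: "'v \<Rightarrow> real"
    and p :: ereal
    and f :: "'v \<Rightarrow> real"
    and K K\<^sub>t :: "real \<Rightarrow> 'v \<Rightarrow> real"
    and \<gamma> :: real
  defines "u \<equiv> heat_semigroup E w m f"
    and "\<mu> \<equiv> spectrum_bottom E w m"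
    and "D \<equiv> max_rel_deg E w m"
  assumes graph: "weighted_graph E w m"
    and p: "1 \<le> p"
    and f: "f \<in> lp_space m p"
    and K_nonneg: "\<And>t x. 0 \<le> t \<Longrightarrow> 0 \<le> K t x"
    and K_nonincreasing: "\<And>x. antimono_on {0..} (\<lambda>t. K t x)"
    and K_deriv: "\<And>t x. 0 \<le> t \<Longrightarrow>
          ((\<lambda>s. K s x) has_real_derivative K\<^sub>t t x) (at t within {0..})"
    and K_deriv_cont: "\<And>x. continuous_on {0..} (\<lambda>t. K\<^sub>t t x)"
    and \<gamma>: "0 \<le> \<gamma>" "\<gamma> \<le> 1"
    and K_ineq: "\<And>t x y. 0 \<le> t \<Longrightarrow> (x, y) \<in> E \<Longrightarrow>
          (K t x + K t y - 2 * (1 - \<gamma>) * sqrt (K t x * K t y))\<^sup>2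
            \<le> (1 / D * K\<^sub>t t x - 2 * \<gamma> * K t x) * (1 / D * K\<^sub>t t y - 2 * \<gamma> * K t y)"
  shows "antimono_on {0..} (\<lambda>t. ennreal (exp (2 * (1 - \<gamma>) * \<mu> * t)) *
           (\<Sum>\<^sub>\<infinity>x. ennreal (K t x * (u t x)\<^sup>2 * m x)))"
proof (rule monotone_onI)
  interpret weighted_graph E w m by (rule graph)
  fix s t :: real
  assume st: "s \<in> {0..}" "t \<in> {0..}" "s \<le> t"
  have tame: "tame f" using f p by (rule tame_lp_space)
  have u: "u r x = heat UNIV f r x" if "0 \<le> r" for r x
    unfolding u_def using heat_semigroup_eq[OF tame that] .
  have K\<^sub>t_nonpos: "K\<^sub>t r x \<le> 0" if "0 \<le> r" for r x
    using antimono_on_derivative_nonpos[OF K_nonincreasing that K_deriv[OF that]] .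
  have "ennreal (exp (2 * (1 - \<gamma>) * \<mu> * t)) * (\<Sum>\<^sub>\<infinity>x. ennreal (K t x * (heat UNIV f t x)\<^sup>2 * m x))
      \<le> ennreal (exp (2 * (1 - \<gamma>) * \<mu> * s)) * (\<Sum>\<^sub>\<infinity>x. ennreal (K s x * (heat UNIV f s x)\<^sup>2 * m x))"
  proof (rule heat_weighted_energy_le[OF tame, where K = K and K' = K\<^sub>t])
    show "rayleigh_bound \<mu>"
      unfolding \<mu>_def by (rule rayleigh_bound_spectrum_bottom)
  qed (use st K_nonneg K\<^sub>t_nonpos K_deriv \<gamma> K_ineq[unfolded D_def] in simp_all)
  then show "ennreal (exp (2 * (1 - \<gamma>) * \<mu> * t)) * (\<Sum>\<^sub>\<infinity>x. ennreal (K t x * (u t x)\<^sup>2 * m x))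
      \<le> ennreal (exp (2 * (1 - \<gamma>) * \<mu> * s)) * (\<Sum>\<^sub>\<infinity>x. ennreal (K s x * (u s x)\<^sup>2 * m x))"
    using st by (simp only: u atLeast_iff)
qed

end
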